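(* Let $G$ be a cyclotomic $\mathcal{L}$-graph with edge labels from $\mathcal{O}_{\mathbb{Q}(\sqrt{-2})}$ or from $\mathcal{O}_{\mathbb{Q}(\sqrt{-7})}$. If $G$ has a vertex of weighted degree $1$, $2$ or $3$, then $G$ is not maximal.
   Context: For $R=\mathcal{O}_{\mathbb{Q}(\sqrt{d})}$ ($d\in\{-2,-7\}$) and $n\ge1$ let $\mathcal{L}_n=\{x\in R: x\bar x=n\}$, $\mathcal{L}=\{0\}\cup\mathcal{L}_1\cup\mathcal{L}_2\cup\mathcal{L}_3\cup\mathcal{L}_4$. A (charged) $\mathcal{L}$-graph on $n$ vertices is identified with an $n\times n$ Hermitian matrix $A$ whose diagonal entries (charges) lie in $\{0,1,-1\}$ and whose off-diagonal entries lie in $\mathcal{L}$; a nonzero $A_{ij}$ ($i\ne j$) is an edge between $i$ and $j$ of weight $A_{ij}\overline{A_{ij}}$. The weighted degree of a vertex $v$ is the sum of the weights of the edges at $v$, plus $1$ if $v$ has nonzero charge. The graph is cyclotomic if all eigenvalues of $A$ lie in $[-2,2]$, connected if $A$ is not permutation-similar to a block diagonal matrix with more than one block. $H$ is contained in $G$ if the matrix of $H$ is obtained (up to simultaneous permutation) from that of $G$ by deleting some rows and corresponding columns. A connected cyclotomic $\mathcal{L}$-graph is maximal if it is not contained in a strictly larger connected cyclotomic $\mathcal{L}$-graph. *)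

theory Defs
  imports
    "Jordan_Normal_Form.Schur_Decomposition"
    "Jordan_Normal_Form.DL_Submatrix"
begin

definition quadratic_field :: "int \<Rightarrow> complex set" where
  "quadratic_field d = {a + b * csqrt (of_int d) | a b. a \<in> \<rat> \<and> b \<in> \<rat>}"

definition quadratic_integers :: "int \<Rightarrow> complex set" where
  "quadratic_integers d = {x \<in> quadratic_field d. algebraic_int x}"

definition norm_labels :: "int \<Rightarrow> nat \<Rightarrow> complex set" where
  "norm_labels d n = {x \<in> quadratic_integers d. x * cnj x = of_nat n}"

definition edge_labels :: "int \<Rightarrow> complex set" where
  "edge_labels d =
     {0} \<union> norm_labels d 1 \<union> norm_labels d 2 \<union> norm_labels d 3 \<union> norm_labels d 4"

definition L_graph :: "int \<Rightarrow> complex mat \<Rightarrow> bool" where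
  "L_graph d A \<longleftrightarrow>
     square_mat A \<and> mat_adjoint A = A \<and>
     (\<forall>i < dim_row A. A $$ (i, i) \<in> {0, 1, -1}) \<and>
     (\<forall>i < dim_row A. \<forall>j < dim_row A. i \<noteq> j \<longrightarrow> A $$ (i, j) \<in> edge_labels d)"

definition weighted_degree :: "complex mat \<Rightarrow> nat \<Rightarrow> complex" where
  "weighted_degree A v =
     (\<Sum>j \<in> {j. j < dim_row A \<and> j \<noteq> v \<and> A $$ (v, j) \<noteq> 0}. A $$ (v, j) * cnj (A $$ (v, j)))
     + (if A $$ (v, v) \<noteq> 0 then 1 else 0)"

definition cyclotomic :: "complex mat \<Rightarrow> bool" where
  "cyclotomic A \<longleftrightarrow> (\<forall>k. eigenvalue A k \<longrightarrow> k \<in> complex_of_real ` {-2..2})"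

definition permute_mat :: "(nat \<Rightarrow> nat) \<Rightarrow> 'a mat \<Rightarrow> 'a mat" where
  "permute_mat p A = mat (dim_row A) (dim_col A) (\<lambda>(i, j). A $$ (p i, p j))"

definition permutation_similar :: "'a mat \<Rightarrow> 'a mat \<Rightarrow> bool" where
  "permutation_similar A B \<longleftrightarrow> (\<exists>p. p permutes {..<dim_row A} \<and> B = permute_mat p A)"

text \<open>Blocks of size zero are excluded: they would make every matrix block diagonal with
  several blocks.\<close>

definition connected_graph :: "complex mat \<Rightarrow> bool" where
  "connected_graph A \<longleftrightarrow>
     \<not> (\<exists>Bs. length Bs > 1 \<and> (\<forall>B \<in> set Bs. square_mat B \<and> dim_row B > 0) \<and>
          permutation_similar A (diag_block_mat Bs))"

definition contained_in :: "complex mat \<Rightarrow> complex mat \<Rightarrow> bool" where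
  "contained_in H G \<longleftrightarrow>
     (\<exists>I \<subseteq> {..<dim_row G}. permutation_similar (submatrix G I I) H)"

definition maximal_graph :: "int \<Rightarrow> complex mat \<Rightarrow> bool" where
  "maximal_graph d G \<longleftrightarrow>
     L_graph d G \<and> cyclotomic G \<and> connected_graph G \<and>
     \<not> (\<exists>G'. L_graph d G' \<and> cyclotomic G' \<and> connected_graph G' \<and>
          dim_row G < dim_row G' \<and> contained_in G G')"

end

theory Submission
  imports Defs
begin

text \<open>Write \<open>A\<close> for the matrix of \<open>G\<close>, so that \<open>D = 4 - A\<^sup>2\<close> is positive semidefinite with integral
  entries and diagonal \<open>4 - deg v\<close>. If \<open>y\<close> is a vector with \<open>y\<^sup>*Dy \<le> 1\<close>, then bordering \<open>A\<close> by the column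
  \<open>Dy\<close> and a diagonal entry close enough to \<open>-y\<^sup>*DAy\<close> keeps all eigenvalues in \<open>[-2, 2]\<close>; this is the
  compression of the Halmos dilation of \<open>A\<close>. So \<open>G\<close> is not maximal as soon as some such
  \<open>Dy\<close> is nonzero and integral and an integer is admissible on the diagonal. A vertex of degree 3 supplies \<open>y = e\<^sub>v\<close>, and a vertex of degree 2 on an edge of weight 2
  supplies a multiple of \<open>e\<^sub>v\<close>. Otherwise all degrees are at most 2 or equal to 4, and vertices of
  degree at most 2 only carry entries \<open>\<plusminus>1\<close>. If no vertex has degree 4, then \<open>2 \<plusminus> A\<close> is a sum of squares
  indexed by the edges, and one can attach a pendant vertex or double a vertex. If \<open>u\<close> has degree 4,
  then \<open>De\<^sub>u = 0\<close>; comparing the columns of its neighbours of degree at most 2 leaves only fragments of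
  a signed 4-cube around \<open>u\<close>, each of which has a suitable \<open>y\<close>.\<close>

section \<open>Integers of the two quadratic fields\<close>

text \<open>The obstacle is the bound \<open>y\<^sup>*Dy \<le> 1\<close>. At
  \<open>y = e\<^sub>v\<close> the form is \<open>4 - deg v\<close>, so for degree 1 or 2 the vector
  has to shrink although \<open>Dy\<close> must stay integral. Two kinds of vectors achieve this. If
  \<open>z\<close> is integral and \<open>Dz = \<mu>z\<close>, then \<open>y = z/\<mu>\<close> has
  \<open>Dy = z\<close> and form \<open>z\<^sup>*z/\<mu>\<close>. If \<open>Ay = e\<^sub>w\<close>
  and \<open>y\<^sup>*y = 1/2\<close>, then the form is \<open>4/2 - 1 = 1\<close>, and
  \<open>Dy = 4y - Ae\<^sub>w\<close> only asks for \<open>4y\<close> to be integral. The diagonal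
  entry may be any real number at distance at most \<open>2(1 - y\<^sup>*Dy)\<close> from
  \<open>-y\<^sup>*DAy\<close>. Rounding finds an integer there as long as the form is at most 3/4;
  at the value 1 the entry is forced, and its integrality needs a separate reason. New labels need
  no inspection of their own: a row of a Hermitian matrix with eigenvalues in \<open>[-2, 2]\<close>
  has square norm at most 4.\<close>

lemma trace_of_quadratic_algebraic_int:
  fixes x :: complex
  assumes alg: "algebraic_int x" and nonreal: "x \<notin> \<real>"
    and tr: "x + cnj x \<in> \<rat>" and nm: "x * cnj x = of_int m"
  shows "x + cnj x \<in> \<int>"
proof -
  from tr obtain r s :: int where s: "s > 0" "coprime r s" and xs: "x + cnj x = of_int r / of_int s"
    by (cases rule: Rats_cases') auto
  \<comment> \<open>Up to the factor \<open>s\<close> this is the monic quadratic with roots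
    \<open>x\<close> and \<open>cnj x\<close>; it is primitive since \<open>r\<close> and
    \<open>s\<close> are coprime. Gauss's lemma follows: pseudo-division by \<open>q\<close> leaves
    a remainder of degree below 2 that vanishes at the nonreal \<open>x\<close>, hence is
    zero.\<close>
  define q where "q = [:m * s, -r, s:]"
  have q: "q \<noteq> 0" "degree q = 2" "lead_coeff q = s" using s by (auto simp: q_def)
  have "content q = gcd (m * s) (gcd r s)"
    using s by (auto simp: q_def content_def cCons_def)
  also have "gcd r s = 1" using s by (simp add: coprime_iff_gcd_eq_1)
  finally have cq: "content q = 1" by simp
  have qx: "poly (map_poly of_int q) x = 0"
  proof -
    have "poly (map_poly of_int q) x = of_int m * of_int s - of_int r * x + of_int s * x * x"
      by (simp add: q_def of_int_hom.map_poly_pCons_hom algebra_simps)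
    also have "of_int r = of_int s * (x + cnj x)" using xs s by (simp add: field_simps)
    finally show ?thesis unfolding nm[symmetric] by (simp add: algebra_simps)
  qed
  obtain f where f: "poly (map_poly of_int f) x = 0" "lead_coeff f = 1"
    using alg by (auto simp: algebraic_int_altdef_ipoly)
  obtain a g where ag: "a \<noteq> 0" "smult a f = q * g + pseudo_mod f q"
    using pseudo_mod(1)[OF q(1)] by blast
  define h where "h = pseudo_mod f q"
  have dh: "degree h < 2" using pseudo_mod(2)[OF q(1), of f] q by (auto simp: h_def)
  have "poly (map_poly of_int (smult a f)) x = poly (map_poly of_int (q * g + h)) x"
    using ag(2) by (simp add: h_def)
  then have hx: "poly (map_poly of_int h) x = 0"
    using f qx by (simp add: of_int_poly_hom.hom_add of_int_poly_hom.hom_mult of_int_hom.map_poly_hom_smult)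
  have h: "h = [:coeff h 0, coeff h 1:]"
    using dh by (intro poly_eqI) (auto simp: coeff_pCons coeff_eq_0 split: nat.splits)
  have hx': "of_int (coeff h 0) + of_int (coeff h 1) * x = 0"
    using hx by (subst (asm) h) (simp add: of_int_hom.map_poly_pCons_hom mult.commute)
  have h1: "coeff h 1 = 0"
  proof (rule ccontr)
    assume *: "coeff h 1 \<noteq> 0"
    then have "x = - of_int (coeff h 0) / of_int (coeff h 1)" 
      using hx' by (auto simp: field_simps eq_neg_iff_add_eq_0)
    then have "x \<in> \<real>" by simp
    then show False using nonreal by simp
  qed
  with hx' have "h = 0" by (subst h) simp
  then have af: "smult a f = q * g" using ag by (simp add: h_def)
  \<comment> \<open>Comparing contents shows that \<open>g\<close> absorbs the factor
    \<open>a\<close>. So \<open>q\<close> divides the monic \<open>f\<close>, and its leading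
    coefficient \<open>s\<close> is 1.\<close>
  have "content f dvd lead_coeff f" by simp
  then have cf: "content f = 1" using f(2) by (simp add: zdvd1_eq content_def)
  have "content (smult a f) = content q * content g" unfolding af by (rule content_mult)
  then have "\<bar>a\<bar> = content g" using cf cq by simp
  then have "[:a:] dvd g" using const_poly_dvd_iff_dvd_content[of a g] by (metis abs_dvd_iff dvd_refl)
  then obtain g' where g': "g = [:a:] * g'" by (auto elim: dvdE)
  then have "smult a f = smult a (q * g')" using af by simp
  then have "f = q * g'" using ag(1) smult_cancel by blast
  then have "1 = s * lead_coeff g'" using f(2) q(3) lead_coeff_mult by metis
  then have "s = 1" using s(1) by (metis dvd_triv_left zdvd1_eq abs_of_pos)
  then show ?thesis using xs by simp
qed

text \<open>The conditions on \<open>\<omega>\<close> hold for \<open>\<surd>(-2)\<close> with \<open>\<tau> = 0\<close> and for \<open>(1 + \<surd>(-7))/2\<close> with \<open>\<tau> = 1\<close>;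
  in both cases the minimal polynomial is \<open>X\<^sup>2 - \<tau> X + 2\<close>.\<close>

locale quadratic_order =
  fixes \<omega> :: complex and \<tau> :: int
  assumes tau: "\<tau> = 0 \<or> \<tau> = 1"
    and omega_sq: "\<omega> * \<omega> = of_int \<tau> * \<omega> - 2"
    and cnj_omega: "cnj \<omega> = of_int \<tau> - \<omega>"
begin

definition ord :: "complex set" where
  "ord = {of_int a + of_int b * \<omega> | a b. True}"

lemma ordI: "of_int a + of_int b * \<omega> \<in> ord"
  by (auto simp: ord_def)

lemma ord_int: "of_int a \<in> ord"
  using ordI[of a 0] by simp

lemma ord_0: "0 \<in> ord" and ord_1: "1 \<in> ord"
  using ord_int[of 0] ord_int[of 1] by simp_all

lemma ord_add: "x \<in> ord \<Longrightarrow> y \<in> ord \<Longrightarrow> x + y \<in> ord"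
proof -
  assume "x \<in> ord" "y \<in> ord"
  then obtain a b a' b' where "x = of_int a + of_int b * \<omega>" "y = of_int a' + of_int b' * \<omega>"
    by (auto simp: ord_def)
  then have "x + y = of_int (a + a') + of_int (b + b') * \<omega>" by (simp add: algebra_simps)
  then show ?thesis by (simp only: ordI)
qed

lemma ord_minus: "x \<in> ord \<Longrightarrow> - x \<in> ord"
proof -
  assume "x \<in> ord"
  then obtain a b where "x = of_int a + of_int b * \<omega>" by (auto simp: ord_def)
  then have "- x = of_int (-a) + of_int (-b) * \<omega>" by (simp add: algebra_simps)
  then show ?thesis by (simp only: ordI)
qed

lemma ord_diff: "x \<in> ord \<Longrightarrow> y \<in> ord \<Longrightarrow> x - y \<in> ord"
  using ord_add[of x "- y"] ord_minus by simp

lemma ord_mult: "x \<in> ord \<Longrightarrow> y \<in> ord \<Longrightarrow> x * y \<in> ord"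
proof -
  assume "x \<in> ord" "y \<in> ord"
  then obtain a b a' b' where xy: "x = of_int a + of_int b * \<omega>" "y = of_int a' + of_int b' * \<omega>"
    by (auto simp: ord_def)
  have "x * y = of_int (a * a') + of_int (a * b' + b * a') * \<omega> + of_int (b * b') * (\<omega> * \<omega>)"
    by (simp add: xy algebra_simps)
  also have "\<dots> = of_int (a * a' - 2 * b * b') + of_int (a * b' + b * a' + \<tau> * b * b') * \<omega>"
    unfolding omega_sq by (simp add: algebra_simps)
  finally show ?thesis by (simp only: ordI)
qed

lemma ord_sum: "(\<And>i. i \<in> I \<Longrightarrow> f i \<in> ord) \<Longrightarrow> sum f I \<in> ord"
  by (induction I rule: infinite_finite_induct) (auto simp: ord_0 ord_add)

lemma ord_cnj: "x \<in> ord \<Longrightarrow> cnj x \<in> ord"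
proof -
  assume "x \<in> ord"
  then obtain a b where "x = of_int a + of_int b * \<omega>" by (auto simp: ord_def)
  then have "cnj x = of_int (a + \<tau> * b) + of_int (-b) * \<omega>" by (simp add: cnj_omega algebra_simps)
  then show ?thesis by (simp only: ordI)
qed

lemma omega_not_real: "\<omega> \<notin> \<real>"
proof
  assume "\<omega> \<in> \<real>"
  then obtain w where w: "\<omega> = of_real w" by (auto simp: Reals_def)
  have "complex_of_real (w * w) = complex_of_real (of_int \<tau> * w - 2)"
    using omega_sq unfolding w by simp
  then have "w * w = of_int \<tau> * w - 2" using of_real_eq_iff by blast
  moreover have "w * w - of_int \<tau> * w + 2 > 0"
    using tau
  proof
    assume "\<tau> = 0"
    then show ?thesis using zero_le_square[of w] by (simp del: zero_le_square)
  next
    assume "\<tau> = 1"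
    then show ?thesis using zero_le_square[of "w - 1/2"] by (simp add: algebra_simps del: zero_le_square)
  qed
  ultimately show False by simp
qed

lemma ord_real_int:
  assumes "x \<in> ord" "x \<in> \<real>"
  shows "x \<in> \<int>"
proof -
  obtain a b where x: "x = of_int a + of_int b * \<omega>" using assms by (auto simp: ord_def)
  have "b = 0"
  proof (rule ccontr)
    assume "b \<noteq> 0"
    then have "\<omega> = (x - of_int a) / of_int b" using x by (simp add: field_simps)
    then have "\<omega> \<in> \<real>" using assms(2) by simp
    then show False using omega_not_real by simp
  qed
  then show ?thesis using x by simp
qed

lemma ord_norm:
  assumes "x = of_int a + of_int b * \<omega>"
  shows "x * cnj x = of_int (a * a + \<tau> * a * b + 2 * b * b)"
proof -
  have "x * cnj x = of_int (a * a) + of_int (\<tau> * a * b) + of_int (b * b) * (of_int \<tau> * \<omega> - \<omega> * \<omega>)"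
    by (simp add: assms cnj_omega algebra_simps)
  then show ?thesis unfolding omega_sq by (simp add: algebra_simps)
qed

lemma ord_norm_nat:
  assumes "x \<in> ord"
  obtains k :: nat where "x * cnj x = of_nat k" "(cmod x)\<^sup>2 = real k"
proof -
  have "x * cnj x \<in> \<int>"
    using assms by (intro ord_real_int ord_mult ord_cnj) (auto simp: complex_is_Real_iff)
  then obtain k where k: "x * cnj x = of_int k" by (auto elim: Ints_cases)
  have c: "x * cnj x = of_real ((cmod x)\<^sup>2)" by (simp only: complex_norm_square)
  have "complex_of_real ((cmod x)\<^sup>2) = complex_of_real (of_int k)" using k c by simp
  then have r: "(cmod x)\<^sup>2 = of_int k" using of_real_eq_iff by blast
  then have "k \<ge> 0" by (metis of_int_0_le_iff zero_le_power2)
  then show ?thesis using that[of "nat k"] k r by simp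
qed

text \<open>Four times the norm is
  \<open>(2a + \<tau>b)\<^sup>2 + (8 - \<tau>\<^sup>2)b\<^sup>2\<close>, whose last coefficient is
  at least 7, so norm 1 forces \<open>b = 0\<close>. This is what turns every edge of weight 1 into
  a sign.\<close>

lemma ord_norm_one:
  assumes "x \<in> ord" "cmod x = 1"
  shows "x = 1 \<or> x = -1"
proof -
  obtain a b where x: "x = of_int a + of_int b * \<omega>" using assms by (auto simp: ord_def)
  have "x * cnj x = 1" using assms(2) complex_norm_square[of x] by simp
  then have "a * a + \<tau> * a * b + 2 * b * b = 1" using ord_norm[OF x] by (metis of_int_eq_1_iff)
  then have e: "(2 * a + \<tau> * b)\<^sup>2 + (8 - \<tau> * \<tau>) * b\<^sup>2 = 4"
    by (simp add: power2_eq_square algebra_simps)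
  have "7 * b\<^sup>2 \<le> (8 - \<tau> * \<tau>) * b\<^sup>2" using tau by auto
  with e have "7 * b\<^sup>2 \<le> 4" by (smt (verit) zero_le_power2)
  then have "b\<^sup>2 < 1" by simp
  then have b: "b = 0" by (metis int_one_le_iff_zero_less not_less zero_less_power2)
  with e have "a\<^sup>2 = 1" by simp
  then have "a = 1 \<or> a = -1" by (simp add: power2_eq_1_iff)
  then show ?thesis using x b by auto
qed

lemma ord_algebraic_int:
  assumes "x \<in> ord"
  shows "algebraic_int x"
proof -
  obtain a b where x: "x = of_int a + of_int b * \<omega>" using assms by (auto simp: ord_def)
  define q where "q = [:a * a + \<tau> * a * b + 2 * b * b, -(2 * a + \<tau> * b), 1:]"
  have t: "x + cnj x = of_int (2 * a + \<tau> * b)" by (simp add: x cnj_omega algebra_simps)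
  have "poly (map_poly of_int q) x
      = of_int (a * a + \<tau> * a * b + 2 * b * b) - of_int (2 * a + \<tau> * b) * x + x * x"
    by (simp add: q_def of_int_hom.map_poly_pCons_hom algebra_simps)
  also have "\<dots> = 0" unfolding t[symmetric] ord_norm[OF x, symmetric] by (simp add: algebra_simps)
  finally show ?thesis unfolding algebraic_int_altdef_ipoly by (intro exI[of _ q]) (simp add: q_def)
qed

end

section \<open>The labels as elements of the maximal order\<close>

lemma csqrt_neg:
  assumes "d < 0"
  shows "csqrt (of_int d) = \<i> * of_real (sqrt (of_int (- d)))"
  using assms by simp

lemma rational_square_int:
  fixes q :: real
  assumes "q \<in> \<rat>" "q\<^sup>2 = of_int k"
  shows "q \<in> \<int>"
proof -
  have "algebraic_int q"
    by (rule algebraic_int_root[where p = "[:0, 0, 1:]" and y = "of_int k"])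
       (use assms(2) in \<open>auto simp: power2_eq_square coeff_pCons split: nat.splits\<close>)
  with assms(1) show ?thesis using rational_algebraic_int_is_int by blast
qed

text \<open>The trace \<open>P\<close> is an integer because \<open>x\<close> is algebraic with
  integral norm. If \<open>q\<close> is the coefficient of the root, then \<open>K = -d * 2q\<close>
  has an integral square, so it is an integer; the prime \<open>-d\<close> divides
  \<open>K\<^sup>2\<close> and hence \<open>K\<close>, which makes \<open>Q = 2q\<close>
  integral.\<close>

lemma quadratic_integer_coordinates:
  assumes d: "d \<in> {-2, -7}" and x: "x \<in> quadratic_integers d" and nm: "x * cnj x = of_int m"
  obtains P Q :: int where "x = (of_int P + of_int Q * csqrt (of_int d)) / 2" "P\<^sup>2 - d * Q\<^sup>2 = 4 * m"
proof -
  define r where "r = sqrt (of_int (- d))"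
  have r: "r > 0" "r\<^sup>2 = of_int (- d)" "csqrt (of_int d) = \<i> * of_real r" using d csqrt_neg[of d] by (auto simp: r_def)
  obtain a b where ab: "x = a + b * csqrt (of_int d)" "a \<in> \<rat>" "b \<in> \<rat>" and alg: "algebraic_int x"
    using x by (auto simp: quadratic_integers_def quadratic_field_def)
  obtain p q :: rat where pq: "a = of_rat p" "b = of_rat q" using ab by (auto elim!: Rats_cases)
  have of_rat_real: "complex_of_real (of_rat u) = of_rat u" for u :: rat
    by (cases u) (simp add: of_rat_rat)
  have xc: "x = Complex (of_rat p) (of_rat q * r)"
    using ab pq r by (simp add: complex_eq_iff flip: of_rat_real)
  have "x * cnj x = of_real ((of_rat p)\<^sup>2 + (of_rat q * r)\<^sup>2)"
    by (simp add: xc complex_mult_cnj)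
  also note nm
  finally have "complex_of_real (of_int m) = of_real ((of_rat p)\<^sup>2 + (of_rat q * r)\<^sup>2)" by simp
  then have n1: "(of_rat p)\<^sup>2 + (of_rat q)\<^sup>2 * of_int (- d) = real_of_int m"
    using r(2) by (simp only: of_real_eq_iff power_mult_distrib)
  have tr: "x + cnj x = of_real (2 * of_rat p)" by (simp add: xc complex_eq_iff)
  have "x + cnj x \<in> \<int>"
  proof (cases "q = 0")
    case True
    then have "x \<in> \<rat>" using ab pq by simp
    then have "x \<in> \<int>" using alg rational_algebraic_int_is_int by blast
    then show ?thesis by (metis Ints_add Ints_cases complex_cnj_of_int)
  next
    case False
    then have "x \<notin> \<real>" using r(1) by (simp add: xc complex_is_Real_iff)
    moreover have "x + cnj x \<in> \<rat>" unfolding tr by (simp add: of_rat_real)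
    ultimately show ?thesis using trace_of_quadratic_algebraic_int alg nm by blast
  qed
  then obtain P where "x + cnj x = of_int P" by (auto elim: Ints_cases)
  then have "complex_of_real (2 * of_rat p) = of_real (of_int P)" using tr by simp
  then have P: "2 * of_rat p = real_of_int P" using of_real_eq_iff by blast
  have n2: "of_int (- d) * (2 * of_rat q)\<^sup>2 = real_of_int (4 * m - P\<^sup>2)"
    using n1 P[symmetric] by (simp add: power2_eq_square algebra_simps)
  have "(of_int (- d) * (2 * of_rat q))\<^sup>2 = real_of_int (- d * (4 * m - P\<^sup>2))"
    unfolding of_int_mult n2[symmetric] by (simp add: power2_eq_square)
  moreover have "of_int (- d) * (2 * of_rat q) \<in> (\<rat> :: real set)" by simp
  ultimately have "of_int (- d) * (2 * of_rat q) \<in> (\<int> :: real set)"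
    using rational_square_int by blast
  then obtain K where K: "of_int (- d) * (2 * of_rat q) = real_of_int K" by (blast elim: Ints_cases)
  have "real_of_int (K\<^sup>2) = real_of_int (- d * (4 * m - P\<^sup>2))"
    using \<open>(of_int (- d) * (2 * of_rat q))\<^sup>2 = _\<close> unfolding K by simp
  then have K2: "K\<^sup>2 = - d * (4 * m - P\<^sup>2)" using of_int_eq_iff by blast
  have "prime (- d)" using d by auto
  moreover have "- d dvd K\<^sup>2" unfolding K2 by simp
  ultimately have "- d dvd K" using prime_dvd_power by blast
  then obtain Q where Q: "K = - d * Q" by (rule dvdE)
  have "real_of_int (- d) \<noteq> 0" using d by auto
  then have q: "2 * of_rat q = real_of_int Q" using K unfolding Q by simp
  have "x = (of_int P + of_int Q * csqrt (of_int d)) / 2"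
    using P q by (simp add: xc r complex_eq_iff)
  moreover have "- d * Q\<^sup>2 = 4 * m - P\<^sup>2"
  proof -
    have "real_of_int (- d * Q\<^sup>2) = real_of_int (4 * m - P\<^sup>2)" using n2 unfolding q by simp
    then show ?thesis using of_int_eq_iff by blast
  qed
  ultimately show ?thesis using that by (simp add: algebra_simps)
qed

lemma quadratic_order_exists:
  assumes d: "d \<in> {-2, -7}"
  obtains \<omega> \<tau> where "quadratic_order \<omega> \<tau>"
    "quadratic_order.ord \<omega> \<subseteq> quadratic_integers d" "edge_labels d \<subseteq> quadratic_order.ord \<omega>"
proof -
  define \<tau> :: int where "\<tau> = (if d = -2 then 0 else 1)"
  define \<omega> where "\<omega> = (if d = -2 then csqrt (of_int d) else (1 + csqrt (of_int d)) / 2)"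
  have sq: "csqrt (of_int d) = \<i> * of_real (sqrt (of_int (- d)))" using d csqrt_neg[of d] by auto
  interpret quadratic_order \<omega> \<tau>
  proof
    show "\<omega> * \<omega> = of_int \<tau> * \<omega> - 2"
    proof -
      have "csqrt (of_int d) * csqrt (of_int d) = of_int d"
        by (metis power2_csqrt power2_eq_square)
      then show ?thesis using d by (auto simp: \<omega>_def \<tau>_def field_simps)
    qed
    show "cnj \<omega> = of_int \<tau> - \<omega>"
      using d unfolding \<omega>_def \<tau>_def sq by (auto simp: complex_eq_iff)
  qed (auto simp: \<tau>_def)
  have "ord \<subseteq> quadratic_integers d"
  proof
    fix x assume x: "x \<in> ord"
    then obtain a b where ab: "x = of_int a + of_int b * \<omega>" by (auto simp: ord_def)
    have "x \<in> quadratic_field d"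
    proof (cases "d = -2")
      case True
      then have "x = of_int a + of_int b * csqrt (of_int d)" by (simp add: ab \<omega>_def)
      then show ?thesis unfolding quadratic_field_def using Rats_of_int by blast
    next
      case False
      have "x = (of_int a + of_int b / 2) + (of_int b / 2) * csqrt (of_int d)"
        using False unfolding ab \<omega>_def by (simp add: field_simps)
      moreover have "of_int a + of_int b / 2 \<in> (\<rat> :: complex set)" "of_int b / 2 \<in> (\<rat> :: complex set)" by auto
      ultimately show ?thesis unfolding quadratic_field_def by blast
    qed
    then show "x \<in> quadratic_integers d" using ord_algebraic_int[OF x] by (simp add: quadratic_integers_def)
  qed
  moreover have lab: "norm_labels d m \<subseteq> ord" for m
  proof
    fix x assume "x \<in> norm_labels d m"
    then have "x \<in> quadratic_integers d" "x * cnj x = of_int (int m)" by (auto simp: norm_labels_def)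
    from quadratic_integer_coordinates[OF d this] obtain P Q
      where PQ: "x = (of_int P + of_int Q * csqrt (of_int d)) / 2" "P\<^sup>2 - d * Q\<^sup>2 = 4 * int m" by blast
    show "x \<in> ord"
    \<comment> \<open>\<open>P\<close> and \<open>Q\<close> are twice the coordinates for 1 and the
      root of \<open>d\<close>. For \<open>d = -2\<close> the norm equation makes both even; for
      \<open>d = -7\<close> it only makes their parities agree, which is what the basis with
      \<open>(1 + \<surd>(-7))/2\<close> allows.\<close>
    proof (cases "d = -2")
      case True
      then have e: "P\<^sup>2 = 2 * (2 * int m - Q\<^sup>2)" using PQ(2) by simp
      then have "even P" by (metis dvd_triv_left even_power pos2)
      then obtain P' where P': "P = 2 * P'" by (auto elim: dvdE)
      then have "Q\<^sup>2 = 2 * (int m - P'\<^sup>2)" using e by (simp add: power_mult_distrib)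
      then have "even Q" by (metis dvd_triv_left even_power pos2)
      then obtain Q' where Q': "Q = 2 * Q'" by (auto elim: dvdE)
      have "x = of_int P' + of_int Q' * \<omega>" using True PQ(1) by (simp add: P' Q' \<omega>_def add_divide_distrib)
      then show ?thesis by (simp only: ordI)
    next
      case False
      then have "P\<^sup>2 + 7 * Q\<^sup>2 = 2 * (2 * int m)" using PQ(2) d by auto
      then have "even (P\<^sup>2 + 7 * Q\<^sup>2)" by (metis dvd_triv_left)
      then have "even (P - Q)" by auto
      then obtain R where "P - Q = 2 * R" by (rule dvdE)
      then have "P = 2 * R + Q" by simp
      then have "x = of_int R + of_int Q * \<omega>" using False PQ(1) by (simp add: \<omega>_def field_simps)
      then show ?thesis by (simp only: ordI)
    qed
  qed
  then have "edge_labels d \<subseteq> ord"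
    by (auto simp: edge_labels_def ord_0)
  ultimately show ?thesis using that quadratic_order_axioms by blast
qed

section \<open>Hermitian forms and eigenvalues\<close>

text \<open>Vectors are total functions of which only the values below \<open>n\<close> count, so a
  bordered matrix acts on the same functions with one more index.\<close>

definition ip :: "nat \<Rightarrow> (nat \<Rightarrow> complex) \<Rightarrow> (nat \<Rightarrow> complex) \<Rightarrow> complex" where
  "ip n y z = (\<Sum>i<n. cnj (y i) * z i)"

definition ap :: "nat \<Rightarrow> (nat \<Rightarrow> nat \<Rightarrow> complex) \<Rightarrow> (nat \<Rightarrow> complex) \<Rightarrow> nat \<Rightarrow> complex" where
  "ap n A y = (\<lambda>i. \<Sum>j<n. A i j * y j)"

definition hermitian_on :: "nat \<Rightarrow> (nat \<Rightarrow> nat \<Rightarrow> complex) \<Rightarrow> bool" where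
  "hermitian_on n A \<longleftrightarrow> (\<forall>i<n. \<forall>j<n. A j i = cnj (A i j))"

text \<open>For Hermitian \<open>A\<close> this says that \<open>2 + A\<close> and
  \<open>2 - A\<close> are both positive semidefinite.\<close>

definition form_bounded :: "nat \<Rightarrow> (nat \<Rightarrow> nat \<Rightarrow> complex) \<Rightarrow> bool" where
  "form_bounded n A \<longleftrightarrow> (\<forall>y. \<bar>Re (ip n y (ap n A y))\<bar> \<le> 2 * Re (ip n y y))"

lemma ip_cong:
  "(\<And>i. i < n \<Longrightarrow> y i = y' i) \<Longrightarrow> (\<And>i. i < n \<Longrightarrow> z i = z' i) \<Longrightarrow> ip n y z = ip n y' z'"
  by (simp add: ip_def)

lemma ap_cong: "(\<And>i. i < n \<Longrightarrow> y i = y' i) \<Longrightarrow> ap n A y = ap n A y'"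
  by (simp add: ap_def)

lemma ip_add_left: "ip n (\<lambda>i. x i + y i) z = ip n x z + ip n y z"
  and ip_add_right: "ip n z (\<lambda>i. x i + y i) = ip n z x + ip n z y"
  and ip_diff_left: "ip n (\<lambda>i. x i - y i) z = ip n x z - ip n y z"
  and ip_diff_right: "ip n z (\<lambda>i. x i - y i) = ip n z x - ip n z y"
  and ip_scale_left: "ip n (\<lambda>i. k * y i) z = cnj k * ip n y z"
  and ip_scale_right: "ip n y (\<lambda>i. k * z i) = k * ip n y z"
  by (simp_all add: ip_def algebra_simps sum.distrib sum_subtractf sum_distrib_left)

lemma ap_add: "ap n A (\<lambda>i. x i + y i) = (\<lambda>i. ap n A x i + ap n A y i)"
  and ap_diff: "ap n A (\<lambda>i. x i - y i) = (\<lambda>i. ap n A x i - ap n A y i)"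
  and ap_scale: "ap n A (\<lambda>i. k * y i) = (\<lambda>i. k * ap n A y i)"
  by (simp_all add: ap_def algebra_simps sum.distrib sum_subtractf sum_distrib_left)

lemmas ip_ap_simps = ip_add_left ip_add_right ip_diff_left ip_diff_right ip_scale_left
  ip_scale_right ap_add ap_diff ap_scale

lemma cnj_ip: "cnj (ip n y z) = ip n z y"
  by (simp add: ip_def mult.commute)

lemma ip_self: "ip n y y = of_real (\<Sum>i<n. (cmod (y i))\<^sup>2)"
  unfolding ip_def of_real_sum complex_norm_square by (simp add: mult.commute)

lemma hermitian_onD: "hermitian_on n A \<Longrightarrow> i < n \<Longrightarrow> j < n \<Longrightarrow> cnj (A i j) = A j i"
  by (metis hermitian_on_def)

lemma ip_adjoint:
  assumes "hermitian_on n A"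
  shows "ip n (ap n A y) z = ip n y (ap n A z)"
proof -
  have "ip n (ap n A y) z = (\<Sum>i<n. \<Sum>j<n. cnj (A i j) * cnj (y j) * z i)"
    by (simp add: ip_def ap_def sum_distrib_right)
  also have "\<dots> = (\<Sum>i<n. \<Sum>j<n. cnj (y j) * (A j i * z i))"
    by (intro sum.cong refl) (simp only: lessThan_iff hermitian_onD[OF assms] ac_simps)
  also have "\<dots> = (\<Sum>j<n. \<Sum>i<n. cnj (y j) * (A j i * z i))"
    by (rule sum.swap)
  also have "\<dots> = ip n y (ap n A z)"
    by (simp add: ip_def ap_def sum_distrib_left)
  finally show ?thesis .
qed

lemma ip_ap_real:
  assumes "hermitian_on n A"
  shows "ip n y (ap n A y) = of_real (Re (ip n y (ap n A y)))"
proof -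
  have "cnj (ip n y (ap n A y)) = ip n y (ap n A y)"
    using ip_adjoint[OF assms, of y y] by (simp add: cnj_ip)
  then show ?thesis by (simp add: complex_eq_iff)
qed

text \<open>A crude operator bound of which only the finiteness matters: for \<open>A\<close> it
  bounds the Rayleigh quotient from below, for an inverse \<open>Q\<close> it limits the
  second-order term of a perturbation.\<close>

lemma Re_ip_ap_le:
  "\<bar>Re (ip n (ap n B y) y)\<bar> \<le> (\<Sum>i<n. \<Sum>j<n. cmod (B i j)) * Re (ip n y y)"
proof -
  have le: "cmod (y i) \<le> sqrt (Re (ip n y y))" if "i < n" for i
  proof (rule real_le_rsqrt)
    show "(cmod (y i))\<^sup>2 \<le> Re (ip n y y)"
      unfolding ip_self Re_complex_of_real using that by (intro member_le_sum) auto
  qed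
  have pos: "Re (ip n y y) \<ge> 0" by (simp add: ip_self sum_nonneg)
  have "\<bar>Re (ip n (ap n B y) y)\<bar> \<le> cmod (ip n (ap n B y) y)" by (rule abs_Re_le_cmod)
  also have "\<dots> = cmod (\<Sum>i<n. \<Sum>j<n. cnj (B i j) * cnj (y j) * y i)"
    by (simp add: ip_def ap_def sum_distrib_right)
  also have "\<dots> \<le> (\<Sum>i<n. cmod (\<Sum>j<n. cnj (B i j) * cnj (y j) * y i))" by (rule norm_sum)
  also have "\<dots> \<le> (\<Sum>i<n. \<Sum>j<n. cmod (cnj (B i j) * cnj (y j) * y i))"
    by (intro sum_mono norm_sum)
  also have "\<dots> \<le> (\<Sum>i<n. \<Sum>j<n. cmod (B i j) * Re (ip n y y))"
  proof (intro sum_mono)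
    fix i j assume ij: "i \<in> {..<n}" "j \<in> {..<n}"
    have "cmod (y j) * cmod (y i) \<le> sqrt (Re (ip n y y)) * sqrt (Re (ip n y y))"
      using ij le pos by (intro mult_mono) auto
    also have "\<dots> = Re (ip n y y)" using pos by simp
    finally show "cmod (cnj (B i j) * cnj (y j) * y i) \<le> cmod (B i j) * Re (ip n y y)"
      by (simp add: norm_mult mult.assoc mult_left_mono)
  qed
  also have "\<dots> = (\<Sum>i<n. \<Sum>j<n. cmod (B i j)) * Re (ip n y y)"
    by (simp add: sum_distrib_right)
  finally show ?thesis .
qed

text \<open>The infimum \<open>\<mu>\<close> of the Rayleigh quotient is an eigenvalue: if \<open>A - \<mu>\<close> had an inverse \<open>Q\<close>,
  then positivity of the form at \<open>y - s Q y\<close> for a suitable \<open>s > 0\<close> would bound the quotient away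
  from \<open>\<mu>\<close>.\<close>

lemma hermitian_form_lower_bound:
  assumes H: "hermitian_on n A"
    and inv: "\<And>\<mu>. \<mu> < m \<Longrightarrow> \<exists>Q. \<forall>y. \<forall>i<n. ap n A (ap n Q y) i - of_real \<mu> * ap n Q y i = y i"
  shows "m * Re (ip n y y) \<le> Re (ip n y (ap n A y))"
proof (rule ccontr)
  assume neg: "\<not> ?thesis"
  define f where "f y = Re (ip n y (ap n A y))" for y
  define N where "N y = Re (ip n y y)" for y
  have N0: "N y \<ge> 0" for y by (simp add: N_def ip_self sum_nonneg)
  define T where "T = {t. \<forall>y. t * N y \<le> f y}"
  have f_adj: "Re (ip n (ap n A y) y) = f y" for y unfolding f_def by (simp add: ip_adjoint[OF H])
  have "- (\<Sum>i<n. \<Sum>j<n. cmod (A i j)) \<in> T"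
  proof -
    have "- (\<Sum>i<n. \<Sum>j<n. cmod (A i j)) * N y \<le> f y" for y
      using Re_ip_ap_le[of n A y] unfolding f_adj N_def by linarith
    then show ?thesis by (simp add: T_def)
  qed
  then have T: "T \<noteq> {}" by auto
  have Ny: "N y > 0"
  proof (rule ccontr)
    assume "\<not> N y > 0"
    then have 0: "N y = 0" using N0[of y] by simp
    then have "\<bar>Re (ip n (ap n A y) y)\<bar> \<le> 0" using Re_ip_ap_le[of n A y] by (simp add: N_def)
    then show False using neg 0 f_adj[of y] by (simp add: f_def N_def)
  qed
  have up: "t < m" if "t \<in> T" for t
  proof -
    have "t * N y \<le> f y" using that by (simp add: T_def)
    also have "\<dots> < m * N y" using neg by (simp add: f_def N_def)
    finally show ?thesis using Ny by simp
  qed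
  have bdd: "bdd_above T" using up by (meson bdd_aboveI less_imp_le)
  define \<mu> where "\<mu> = Sup T"
  have muT: "\<mu> * N x \<le> f x" for x
  proof (cases "N x = 0")
    case True
    obtain t where "t * N x \<le> f x" using T by (auto simp: T_def)
    then show ?thesis using True by simp
  next
    case False
    then have pos: "N x > 0" using N0[of x] by simp
    have "\<mu> \<le> f x / N x" unfolding \<mu>_def
      using T pos by (intro cSup_least) (auto simp: T_def pos_le_divide_eq)
    then show ?thesis using pos by (simp add: pos_le_divide_eq)
  qed
  then have "\<mu> < m" using up by (simp add: T_def)
  then obtain Q where Q: "\<And>y i. i < n \<Longrightarrow> ap n A (ap n Q y) i - of_real \<mu> * ap n Q y i = y i"
    using inv by blast
  define C where "C = (\<Sum>i<n. \<Sum>j<n. cmod (Q i j)) + 1"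
  have C: "C > 0" unfolding C_def by (simp add: sum_nonneg add_nonneg_pos)
  have "\<mu> + 1 / C \<in> T" unfolding T_def
  proof (intro CollectI allI)
    fix y
    define z where "z = ap n Q y"
    have z: "ip n x (ap n A z) - of_real \<mu> * ip n x z = ip n x y" for x
    proof -
      have "ip n x (\<lambda>i. ap n A z i - of_real \<mu> * z i) = ip n x y"
        using Q by (intro ip_cong) (auto simp: z_def)
      then show ?thesis by (simp add: ip_ap_simps)
    qed
    have zy: "\<bar>Re (ip n z y)\<bar> \<le> C * N y"
    proof -
      have "\<bar>Re (ip n z y)\<bar> \<le> (C - 1) * N y"
        using Re_ip_ap_le[of n Q y] by (simp add: z_def C_def N_def)
      also have "\<dots> \<le> C * N y" using N0 by (intro mult_right_mono) auto
      finally show ?thesis .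
    qed
    \<comment> \<open>With this step the second-order term is at most \<open>s * N y\<close>, half
      of the first-order gain \<open>2 * s * N y\<close>, so a gain of \<open>N y / C\<close>
      survives.\<close>
    define s where "s = 1 / C"
    define u where "u = (\<lambda>i. y i - of_real s * z i)"
    have fu: "ip n u (ap n A u) - of_real \<mu> * ip n u u =
        (ip n y (ap n A y) - of_real \<mu> * ip n y y) - of_real s * ip n y y
        - of_real s * cnj (ip n y y) + of_real (s * s) * ip n z y"
    proof -
      have "ip n u (ap n A u) - of_real \<mu> * ip n u u =
         (ip n y (ap n A y) - of_real \<mu> * ip n y y)
         - of_real s * (ip n y (ap n A z) - of_real \<mu> * ip n y z)
         - of_real s * (ip n z (ap n A y) - of_real \<mu> * ip n z y)
         + of_real (s * s) * (ip n z (ap n A z) - of_real \<mu> * ip n z z)"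
        unfolding u_def by (simp add: ip_ap_simps algebra_simps)
      also have "ip n z (ap n A y) - of_real \<mu> * ip n z y = cnj (ip n y (ap n A z) - of_real \<mu> * ip n y z)"
        by (simp add: cnj_ip ip_adjoint[OF H])
      finally show ?thesis unfolding z .
    qed
    have "0 \<le> Re (ip n u (ap n A u) - of_real \<mu> * ip n u u)"
      using muT[of u] by (simp add: f_def N_def)
    also have "\<dots> = f y - \<mu> * N y - 2 * s * N y + s * (s * Re (ip n z y))"
      unfolding fu by (simp add: f_def N_def algebra_simps)
    also have "s * (s * Re (ip n z y)) \<le> s * (s * (C * N y))"
      using zy C by (intro mult_left_mono) (auto simp: s_def)
    also have "s * (s * (C * N y)) = s * N y" using C by (simp add: s_def)
    finally show "(\<mu> + 1 / C) * N y \<le> f y" by (simp add: s_def algebra_simps)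
  qed
  then have "\<mu> + 1 / C \<le> \<mu>" unfolding \<mu>_def using bdd by (rule cSup_upper)
  then show False using C by simp
qed

section \<open>From the spectrum of a matrix to its Hermitian form\<close>

definition entry :: "complex mat \<Rightarrow> nat \<Rightarrow> nat \<Rightarrow> complex" where
  "entry G i j = G $$ (i, j)"

lemma mult_mat_vec_entry:
  assumes "G \<in> carrier_mat n n" "v \<in> carrier_vec n" "i < n"
  shows "(G *\<^sub>v v) $ i = ap n (entry G) (\<lambda>j. v $ j) i"
  using assms by (simp add: ap_def entry_def scalar_prod_def atLeast0LessThan)

lemma adjoint_entry:
  assumes "G \<in> carrier_mat n n"
  shows "mat_adjoint G = G \<longleftrightarrow> hermitian_on n (entry G)"
proof -
  have ix: "mat_adjoint G $$ (i, j) = cnj (G $$ (j, i))" if "i < n" "j < n" for i j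
    using assms that by (simp add: mat_adjoint_def mat_of_rows_def)
  have dim: "mat_adjoint G \<in> carrier_mat n n" using assms by (auto simp: mat_adjoint_def)
  show ?thesis
  proof
    assume e: "mat_adjoint G = G"
    show "hermitian_on n (entry G)" unfolding hermitian_on_def entry_def
    proof (intro allI impI)
      fix i j assume "i < n" "j < n"
      then show "G $$ (j, i) = cnj (G $$ (i, j))" using ix[of j i] e by simp
    qed
  next
    assume h: "hermitian_on n (entry G)"
    show "mat_adjoint G = G"
    proof (rule eq_matI)
      fix i j assume "i < dim_row G" "j < dim_col G"
      then have "i < n" "j < n" using assms by auto
      then show "mat_adjoint G $$ (i, j) = G $$ (i, j)"
        using ix[of i j] hermitian_onD[OF h, of j i] by (simp add: entry_def)
    qed (use dim assms in auto)
  qed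
qed

lemma resolvent_exists:
  assumes G: "G \<in> carrier_mat n n" and ev: "\<not> eigenvalue G k"
  shows "\<exists>Q. \<forall>y. \<forall>i<n. ap n (entry G) (ap n Q y) i - k * ap n Q y i = y i"
proof -
  define B where "B = G - k \<cdot>\<^sub>m 1\<^sub>m n"
  have B: "B \<in> carrier_mat n n" using G by (auto simp: B_def)
  have smult_one: "(k \<cdot>\<^sub>m 1\<^sub>m n) *\<^sub>v v = k \<cdot>\<^sub>v v" if "v \<in> carrier_vec n" for v
    using that by (intro eq_vecI) (auto simp: smult_scalar_prod_distrib[of _ n])
  have "det B \<noteq> 0"
  proof
    assume "det B = 0"
    then obtain v where v: "v \<in> carrier_vec n" "v \<noteq> 0\<^sub>v n" "B *\<^sub>v v = 0\<^sub>v n"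
      using det_0_iff_vec_prod_zero[OF B] by auto
    have "B *\<^sub>v v = G *\<^sub>v v - k \<cdot>\<^sub>v v"
      using G v(1) by (simp add: B_def minus_mult_distrib_mat_vec smult_one)
    then have e: "G *\<^sub>v v - k \<cdot>\<^sub>v v = 0\<^sub>v n" using v by simp
    have "G *\<^sub>v v = k \<cdot>\<^sub>v v"
    proof (rule eq_vecI)
      fix i assume "i < dim_vec (k \<cdot>\<^sub>v v)"
      then have i: "i < n" using v by simp
      have "(G *\<^sub>v v - k \<cdot>\<^sub>v v) $ i = 0" unfolding e using i by simp
      then show "(G *\<^sub>v v) $ i = (k \<cdot>\<^sub>v v) $ i" using i v G by simp
    qed (use G v in auto)
    then show False using ev v G by (auto simp: eigenvalue_def eigenvector_def)
  qed
  then obtain Q where Q: "Q \<in> carrier_mat n n" "B * Q = 1\<^sub>m n"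
    using det_non_zero_imp_unit[OF B] B
    unfolding Units_def by (auto simp: ring_mat_def)
  have "ap n (entry G) (ap n (entry Q) y) i - k * ap n (entry Q) y i = y i" if i: "i < n" for y i
  proof -
    define v where "v = vec n y"
    define w where "w = Q *\<^sub>v v"
    have v: "v \<in> carrier_vec n" and w: "w \<in> carrier_vec n" using Q by (auto simp: v_def w_def)
    have wi: "w $ j = ap n (entry Q) y j" if "j < n" for j
      using mult_mat_vec_entry[OF Q(1) v that] by (simp add: w_def v_def ap_def)
    have "B *\<^sub>v w = v" unfolding w_def
      using assoc_mult_mat_vec[OF B Q(1) v] Q(2) v by simp
    moreover have "B *\<^sub>v w = G *\<^sub>v w - k \<cdot>\<^sub>v w"
      using G w by (simp add: B_def minus_mult_distrib_mat_vec smult_one)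
    ultimately have "(G *\<^sub>v w - k \<cdot>\<^sub>v w) $ i = v $ i" by simp
    then have "(G *\<^sub>v w) $ i - k * w $ i = v $ i" using i w G by simp
    moreover have "(G *\<^sub>v w) $ i = ap n (entry G) (ap n (entry Q) y) i"
      using mult_mat_vec_entry[OF G w i] wi by (simp add: ap_def)
    ultimately show ?thesis using wi[OF i] i by (simp add: v_def)
  qed
  then show ?thesis by blast
qed

text \<open>The lower bound on Rayleigh quotients is applied to \<open>A\<close> and to
  \<open>-A\<close>, since no real number outside \<open>[-2, 2]\<close> is an eigenvalue.
  Conversely the form at an eigenvector equals the eigenvalue times a positive number, and it is
  real because \<open>A\<close> is Hermitian.\<close>

lemma cyclotomic_iff_form_bounded:
  assumes G: "G \<in> carrier_mat n n" and H: "hermitian_on n (entry G)"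
  shows "cyclotomic G \<longleftrightarrow> form_bounded n (entry G)"
proof
  assume cyc: "cyclotomic G"
  have no_ev: "\<not> eigenvalue G (of_real \<mu>)" if "\<bar>\<mu>\<bar> > 2" for \<mu>
  proof
    assume "eigenvalue G (of_real \<mu>)"
    then have "complex_of_real \<mu> \<in> complex_of_real ` {-2..2}" using cyc unfolding cyclotomic_def by blast
    then have "\<mu> \<in> {-2..2}" by (simp add: image_iff)
    then show False using that by auto
  qed
  have low: "-2 * Re (ip n y y) \<le> Re (ip n y (ap n (entry G) y))" for y
    by (rule hermitian_form_lower_bound[OF H]) (use no_ev in \<open>auto intro!: resolvent_exists[OF G]\<close>)
  have H': "hermitian_on n (\<lambda>i j. - entry G i j)" using hermitian_onD[OF H] by (simp add: hermitian_on_def)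
  have neg: "ap n (\<lambda>i j. - entry G i j) y = (\<lambda>i. (-1) * ap n (entry G) y i)" for y
    by (simp add: ap_def sum_negf)
  have "-2 * Re (ip n y y) \<le> Re (ip n y (ap n (\<lambda>i j. - entry G i j) y))" for y
  proof (rule hermitian_form_lower_bound[OF H'])
    fix \<mu> :: real assume "\<mu> < -2"
    then have "\<not> eigenvalue G (of_real (- \<mu>))" by (intro no_ev) auto
    from resolvent_exists[OF G this] obtain Q
      where Q: "\<And>y i. i < n \<Longrightarrow> ap n (entry G) (ap n Q y) i - of_real (- \<mu>) * ap n Q y i = y i"
      by blast
    have negQ: "ap n (\<lambda>i j. - Q i j) y = (\<lambda>i. (-1) * ap n Q y i)" for y
      by (simp add: ap_def sum_negf)
    have "ap n (\<lambda>i j. - entry G i j) (ap n (\<lambda>i j. - Q i j) y) i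
        - of_real \<mu> * ap n (\<lambda>i j. - Q i j) y i = y i" if "i < n" for y i
      unfolding neg negQ ap_scale using Q[OF that, of y] by simp
    then show "\<exists>Q. \<forall>y. \<forall>i<n. ap n (\<lambda>i j. - entry G i j) (ap n Q y) i - of_real \<mu> * ap n Q y i = y i"
      by blast
  qed
  then have up: "Re (ip n y (ap n (entry G) y)) \<le> 2 * Re (ip n y y)" for y
    unfolding neg ip_scale_right by simp
  show "form_bounded n (entry G)" unfolding form_bounded_def
  proof
    fix y
    show "\<bar>Re (ip n y (ap n (entry G) y))\<bar> \<le> 2 * Re (ip n y y)" using low[of y] up[of y] by linarith
  qed
next
  assume fb: "form_bounded n (entry G)"
  show "cyclotomic G" unfolding cyclotomic_def
  proof (intro allI impI)
    fix k assume "eigenvalue G k"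
    then obtain v where v: "v \<in> carrier_vec n" "v \<noteq> 0\<^sub>v n" "G *\<^sub>v v = k \<cdot>\<^sub>v v"
      using G by (auto simp: eigenvalue_def eigenvector_def)
    define y where "y = (\<lambda>j. v $ j)"
    have ay: "ap n (entry G) y i = k * y i" if "i < n" for i
    proof -
      have "(G *\<^sub>v v) $ i = k * v $ i" unfolding v(3) using v(1) that by simp
      then show ?thesis using mult_mat_vec_entry[OF G v(1) that] by (simp add: y_def)
    qed
    define N where "N = (\<Sum>i<n. (cmod (y i))\<^sup>2)"
    have N: "ip n y y = of_real N" by (simp add: N_def ip_self)
    have "N > 0"
    proof -
      obtain i where i: "i < n" "v $ i \<noteq> 0" using v(1,2) by (metis carrier_vecD eq_vecI index_zero_vec(1,2))
      then show ?thesis unfolding N_def by (intro sum_pos2[of _ i]) (auto simp: y_def)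
    qed
    have e: "ip n y (ap n (entry G) y) = k * of_real N"
    proof -
      have "ip n y (ap n (entry G) y) = ip n y (\<lambda>i. k * y i)" using ay by (intro ip_cong) auto
      then show ?thesis by (simp add: ip_scale_right N)
    qed
    then have "k * of_real N = of_real (Re (k * of_real N))" using ip_ap_real[OF H, of y] by simp
    then have "Im k = 0" using \<open>N > 0\<close> by (simp add: complex_eq_iff)
    then have k: "k = of_real (Re k)" by (simp add: complex_eq_iff)
    have "\<bar>Re k * N\<bar> \<le> 2 * N" using fb[unfolded form_bounded_def, rule_format, of y] unfolding e N by simp
    then have "\<bar>Re k\<bar> \<le> 2" using \<open>N > 0\<close> by (simp add: abs_mult)
    then show "k \<in> complex_of_real ` {-2..2}" using k by (intro image_eqI[of _ _ "Re k"]) auto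
  qed
qed

section \<open>Semidefiniteness of \<open>4 - A\<^sup>2\<close>\<close>

definition delta :: "nat \<Rightarrow> nat \<Rightarrow> complex" where
  "delta i = (\<lambda>j. if j = i then 1 else 0)"

lemma delta_simps: "delta i i = 1" "j \<noteq> i \<Longrightarrow> delta i j = 0"
  by (auto simp: delta_def)

lemma ap_delta: "i < n \<Longrightarrow> ap n A (delta i) = (\<lambda>j. A j i)"
  by (simp add: ap_def delta_def if_distrib cong: if_cong)

lemma ip_delta_left: "i < n \<Longrightarrow> ip n (delta i) y = y i"
proof -
  assume "i < n"
  moreover have "ip n (delta i) y = (\<Sum>j<n. if j = i then y j else 0)"
    unfolding ip_def by (intro sum.cong) (auto simp: delta_def)
  ultimately show ?thesis by simp
qed

text \<open>Subtracting the forms at \<open>Ay + 2y\<close> and \<open>Ay - 2y\<close> isolates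
  \<open>8 |Ay|\<^sup>2\<close>, while by the parallelogram law the two square norms add up to
  \<open>2 |Ay|\<^sup>2 + 8 |y|\<^sup>2\<close>.\<close>

lemma form_bounded_ap_norm:
  assumes H: "hermitian_on n A" and F: "form_bounded n A"
  shows "Re (ip n (ap n A y) (ap n A y)) \<le> 4 * Re (ip n y y)"
proof -
  define u where "u = ap n A y"
  define w where "w = (\<lambda>i. u i + 2 * y i)"
  define w' where "w' = (\<lambda>i. u i - 2 * y i)"
  have uAy: "ip n y (ap n A u) = ip n u u" "ip n u (ap n A y) = ip n u u"
    using ip_adjoint[OF H, of y u] by (simp_all add: u_def)
  have "ip n w (ap n A w) - ip n w' (ap n A w') = 8 * ip n u u"
    unfolding w_def w'_def ip_ap_simps by (simp add: uAy algebra_simps)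
  then have "Re (ip n w (ap n A w) - ip n w' (ap n A w')) = Re (8 * ip n u u)" by (rule arg_cong)
  then have e: "Re (ip n w (ap n A w)) - Re (ip n w' (ap n A w')) = 8 * Re (ip n u u)" by simp
  have "ip n w w + ip n w' w' = 2 * ip n u u + 8 * ip n y y"
    unfolding w_def w'_def ip_ap_simps by (simp add: algebra_simps)
  then have "Re (ip n w w + ip n w' w') = Re (2 * ip n u u + 8 * ip n y y)" by (rule arg_cong)
  then have e2: "Re (ip n w w) + Re (ip n w' w') = 2 * Re (ip n u u) + 8 * Re (ip n y y)" by simp
  have "\<bar>Re (ip n w (ap n A w))\<bar> \<le> 2 * Re (ip n w w)" "\<bar>Re (ip n w' (ap n A w'))\<bar> \<le> 2 * Re (ip n w' w')"
    using F by (auto simp: form_bounded_def)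
  then have "Re (ip n w (ap n A w)) \<le> 2 * Re (ip n w w)" "- Re (ip n w' (ap n A w')) \<le> 2 * Re (ip n w' w')"
    by (simp_all add: abs_le_iff)
  then have "8 * Re (ip n u u) \<le> 2 * (Re (ip n w w) + Re (ip n w' w'))" using e by argo
  then have "4 * Re (ip n u u) \<le> 16 * Re (ip n y y)" unfolding e2 by simp
  then show ?thesis by (simp add: u_def)
qed

text \<open>A semidefinite form vanishes only on the kernel. With \<open>w = -Dx\<close>, moving
  from \<open>x\<close> to \<open>x + w/4\<close> changes the form of \<open>D\<close> by
  \<open>-|w|\<^sup>2/2\<close> to first order and by at most \<open>|w|\<^sup>2/4\<close> to second
  order, because \<open>D \<le> 4\<close>; so \<open>w = 0\<close>.\<close>

lemma form_bounded_extremal: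
  assumes H: "hermitian_on n A" and F: "form_bounded n A"
    and x: "Re (ip n (ap n A x) (ap n A x)) = 4 * Re (ip n x x)" and i: "i < n"
  shows "ap n A (ap n A x) i = 4 * x i"
proof -
  define w where "w = (\<lambda>i. ap n A (ap n A x) i - 4 * x i)"
  define z where "z = (\<lambda>i. x i + (1/4) * w i)"
  have w: "ip n w (ap n A (ap n A x)) = ip n w w + 4 * ip n w x"
    unfolding w_def ip_ap_simps by (simp add: algebra_simps)
  have 1: "ip n (ap n A w) (ap n A x) = ip n w w + 4 * ip n w x"
    using w ip_adjoint[OF H, of w "ap n A x"] by simp
  have r: "Re (ip n y z) = Re (ip n z y)" for y z
    using arg_cong[OF cnj_ip[of n z y], of Re] by simp
  have "ip n (ap n A z) (ap n A z) = ip n (ap n A x) (ap n A x) + (1/4) * ip n (ap n A w) (ap n A x)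
     + (1/4) * ip n (ap n A x) (ap n A w) + (1/16) * ip n (ap n A w) (ap n A w)"
    unfolding z_def ip_ap_simps by (simp add: algebra_simps)
  then have "Re (ip n (ap n A z) (ap n A z)) = Re (ip n (ap n A x) (ap n A x)) + (1/4) * Re (ip n (ap n A w) (ap n A x))
     + (1/4) * Re (ip n (ap n A x) (ap n A w)) + (1/16) * Re (ip n (ap n A w) (ap n A w))"
    by simp
  then have a: "Re (ip n (ap n A z) (ap n A z)) = 4 * Re (ip n x x) + (1/2) * (Re (ip n w w) + 4 * Re (ip n w x))
      + (1/16) * Re (ip n (ap n A w) (ap n A w))"
    unfolding x r[of "ap n A x" "ap n A w"] 1 by simp
  have "ip n z z = ip n x x + (1/4) * ip n w x + (1/4) * ip n x w + (1/16) * ip n w w"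
    unfolding z_def ip_ap_simps by (simp add: algebra_simps)
  then have b: "Re (ip n z z) = Re (ip n x x) + (1/2) * Re (ip n w x) + (1/16) * Re (ip n w w)"
    using r[of x w] by simp
  have "Re (ip n (ap n A w) (ap n A w)) \<ge> 0" by (simp add: ip_self sum_nonneg)
  with form_bounded_ap_norm[OF H F, of z] a b have "Re (ip n w w) \<le> 0" by argo
  then have "(\<Sum>i<n. (cmod (w i))\<^sup>2) \<le> 0" by (simp add: ip_self)
  moreover have "(cmod (w i))\<^sup>2 \<le> (\<Sum>i<n. (cmod (w i))\<^sup>2)" using i by (intro member_le_sum) auto
  ultimately have "(cmod (w i))\<^sup>2 \<le> 0" by linarith
  then have "w i = 0" by simp
  then show ?thesis by (simp add: w_def)
qed

lemma form_bounded_row: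
  assumes "hermitian_on n A" "form_bounded n A" "i < n"
  shows "(\<Sum>j<n. (cmod (A i j))\<^sup>2) \<le> 4"
proof -
  have "(\<Sum>j<n. (cmod (A j i))\<^sup>2) \<le> 4"
    using form_bounded_ap_norm[OF assms(1,2), of "delta i"] assms(3)
    by (simp add: ap_delta ip_delta_left delta_simps ip_self[of _ "\<lambda>j. A j i"])
  moreover have "cmod (A i j) = cmod (A j i)" if "j < n" for j
    using hermitian_onD[OF assms(1) that assms(3)] by (metis complex_mod_cnj)
  ultimately show ?thesis by simp
qed

section \<open>Forms of bordered matrices\<close>

definition bordered :: "nat \<Rightarrow> (nat \<Rightarrow> nat \<Rightarrow> complex) \<Rightarrow> (nat \<Rightarrow> complex) \<Rightarrow> complex \<Rightarrow> nat \<Rightarrow> nat \<Rightarrow> complex"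
  where "bordered n A b c i j =
    (if i < n then if j < n then A i j else b i else if j < n then cnj (b j) else c)"

lemma hermitian_bordered:
  assumes "hermitian_on n A"
  shows "hermitian_on (Suc n) (bordered n A b (of_real c))"
  unfolding hermitian_on_def bordered_def using hermitian_onD[OF assms] by auto

lemma bordered_form:
  "Re (ip (Suc n) y (ap (Suc n) (bordered n A b (of_real c)) y)) =
     Re (ip n y (ap n A y)) + 2 * Re (y n * ip n y b) + c * (cmod (y n))\<^sup>2"
proof -
  have 1: "ap (Suc n) (bordered n A b (of_real c)) y i = ap n A y i + y n * b i" if "i < n" for i
    using that by (simp add: ap_def bordered_def)
  have 2: "ap (Suc n) (bordered n A b (of_real c)) y n = ip n b y + of_real c * y n"
    by (simp add: ap_def bordered_def ip_def)
  have "ip (Suc n) y (ap (Suc n) (bordered n A b (of_real c)) y)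
     = ip n y (ap (Suc n) (bordered n A b (of_real c)) y) + cnj (y n) * (ip n b y + of_real c * y n)"
    by (simp add: ip_def 2)
  also have "ip n y (ap (Suc n) (bordered n A b (of_real c)) y) = ip n y (\<lambda>i. ap n A y i + y n * b i)"
    using 1 by (intro ip_cong) auto
  also have "\<dots> = ip n y (ap n A y) + y n * ip n y b" by (simp add: ip_ap_simps)
  finally have "ip (Suc n) y (ap (Suc n) (bordered n A b (of_real c)) y)
     = ip n y (ap n A y) + (y n * ip n y b + cnj (y n * ip n y b)) + of_real c * (y n * cnj (y n))"
    by (simp add: cnj_ip algebra_simps)
  also have "y n * cnj (y n) = of_real ((cmod (y n))\<^sup>2)" by (simp only: complex_norm_square)
  finally show ?thesis by simp
qed

lemma form_bounded_borderedI:
  assumes "\<And>y t. \<bar>Re (ip n y (ap n A y)) + 2 * Re (t * ip n y b) + c * (cmod t)\<^sup>2\<bar>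
      \<le> 2 * Re (ip n y y) + 2 * (cmod t)\<^sup>2"
  shows "form_bounded (Suc n) (bordered n A b (of_real c))"
  unfolding form_bounded_def
proof
  fix y
  have "ip (Suc n) y y = ip n y y + of_real ((cmod (y n))\<^sup>2)"
    unfolding ip_def complex_norm_square by (simp add: mult.commute)
  then show "\<bar>Re (ip (Suc n) y (ap (Suc n) (bordered n A b (of_real c)) y))\<bar> \<le> 2 * Re (ip (Suc n) y y)"
    using assms[of y "y n"] unfolding bordered_form by simp
qed

section \<open>Connectedness and one-vertex extensions\<close>

text \<open>If no edge crossed the cut, a permutation listing \<open>S\<close> first would produce
  two nonempty diagonal blocks.\<close>

lemma connected_graph_no_cut:
  assumes G: "G \<in> carrier_mat n n" and con: "connected_graph G"
    and S: "S \<subseteq> {..<n}" "S \<noteq> {}" "S \<noteq> {..<n}"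
  shows "\<exists>i\<in>S. \<exists>j\<in>{..<n} - S. G $$ (i, j) \<noteq> 0 \<or> G $$ (j, i) \<noteq> 0"
proof (rule ccontr)
  assume cut: "\<not> ?thesis"
  define k where "k = card S"
  have fin: "finite S" using S(1) finite_subset by blast
  have k: "0 < k" "k < n"
    using S fin psubset_card_mono[of "{..<n}" S] by (auto simp: k_def card_gt_0_iff)
  obtain f where f: "bij_betw f {..<k} S"
    using finite_same_card_bij[of "{..<k}" S] fin by (auto simp: k_def)
  have "card ({..<n} - S) = n - k" using S(1) fin by (simp add: card_Diff_subset k_def)
  then obtain g where g: "bij_betw g {k..<n} ({..<n} - S)"
    using finite_same_card_bij[of "{k..<n}" "{..<n} - S"] by auto
  define p where "p i = (if i < k then f i else if i < n then g i else i)" for i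
  have "bij_betw p {..<k} S" using f by (rule bij_betw_cong[THEN iffD1, rotated]) (auto simp: p_def)
  moreover have "bij_betw p {k..<n} ({..<n} - S)"
    using g by (rule bij_betw_cong[THEN iffD1, rotated]) (auto simp: p_def)
  ultimately have "bij_betw p ({..<k} \<union> {k..<n}) (S \<union> ({..<n} - S))" by (rule bij_betw_combine) auto
  moreover have "{..<k} \<union> {k..<n} = {..<n}" "S \<union> ({..<n} - S) = {..<n}" using k S(1) by auto
  ultimately have "bij_betw p {..<n} {..<n}" by simp
  then have perm: "p permutes {..<n}" by (rule bij_imp_permutes) (use k in \<open>auto simp: p_def\<close>)
  have pS: "p i \<in> S" if "i < k" for i using f that by (auto simp: p_def bij_betw_def)
  have pS': "p i \<in> {..<n} - S" if "k \<le> i" "i < n" for i using g that by (auto simp: p_def bij_betw_def)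
  define B1 where "B1 = mat k k (\<lambda>(i, j). G $$ (p i, p j))"
  define B2 where "B2 = mat (n - k) (n - k) (\<lambda>(i, j). G $$ (p (i + k), p (j + k)))"
  have "diag_block_mat [B1, B2] = permute_mat p G"
  proof (rule eq_matI)
    fix i j assume "i < dim_row (permute_mat p G)" "j < dim_col (permute_mat p G)"
    then have ij: "i < n" "j < n" using G by (auto simp: permute_mat_def)
    have "diag_block_mat [B1, B2] $$ (i, j) =
       (if i < k then if j < k then B1 $$ (i, j) else 0 else if j < k then 0 else B2 $$ (i - k, j - k))"
      using ij k by (auto simp: B1_def B2_def Let_def)
    also have "\<dots> = G $$ (p i, p j)"
      using cut pS pS' ij by (auto simp: B1_def B2_def not_less)
    also have "\<dots> = permute_mat p G $$ (i, j)" using ij G by (simp add: permute_mat_def)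
    finally show "diag_block_mat [B1, B2] $$ (i, j) = permute_mat p G $$ (i, j)" .
  qed (use G k in \<open>auto simp: permute_mat_def B1_def B2_def Let_def\<close>)
  then have "permutation_similar G (diag_block_mat [B1, B2])"
    using perm G by (auto simp: permutation_similar_def)
  moreover have "\<forall>B\<in>set [B1, B2]. square_mat B \<and> dim_row B > 0" using k by (auto simp: B1_def B2_def)
  ultimately show False using con unfolding connected_graph_def by (metis One_nat_def length_Cons lessI list.size(3))
qed

text \<open>The vertices that \<open>p\<close> sends to the first block would form a proper cut
  crossed by no edge.\<close>

lemma connected_graphI:
  assumes G: "G \<in> carrier_mat n n"
    and S: "\<And>S. S \<subseteq> {..<n} \<Longrightarrow> S \<noteq> {} \<Longrightarrow> S \<noteq> {..<n} \<Longrightarrow> \<exists>i\<in>S. \<exists>j\<in>{..<n} - S. G $$ (i, j) \<noteq> 0"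
  shows "connected_graph G"
  unfolding connected_graph_def
proof (rule notI, elim exE conjE)
  fix Bs assume len: "length Bs > 1" and sq: "\<forall>B\<in>set Bs. square_mat B \<and> dim_row B > 0"
    and sim: "permutation_similar G (diag_block_mat Bs)"
  obtain B B' Bs' where Bs: "Bs = B # B' # Bs'"
    using len by (cases Bs; cases "tl Bs") auto
  define E where "E = diag_block_mat (B' # Bs')"
  obtain p where p: "p permutes {..<n}" "diag_block_mat Bs = permute_mat p G"
    using sim G by (auto simp: permutation_similar_def)
  define k where "k = dim_row B"
  have B: "dim_row B = k" "dim_col B = k" "k > 0" using sq by (auto simp: Bs k_def)
  have "square_mat E" unfolding E_def by (rule diag_block_mat_square) (use sq in \<open>auto simp: Bs\<close>)
  then have E: "dim_col E = dim_row E" by simp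
  have blk: "permute_mat p G = four_block_mat B (0\<^sub>m k (dim_row E)) (0\<^sub>m (dim_row E) k) E"
    using p(2) E B by (simp add: Bs E_def Let_def)
  have "dim_row (permute_mat p G) = k + dim_row E" unfolding blk using B by simp
  then have n: "n = k + dim_row E" using G by (simp add: permute_mat_def)
  have "dim_row E > 0" using sq by (simp add: E_def dim_diag_block_mat Bs)
  define S where "S = p ` {..<k}"
  have inj: "inj p" using p(1) permutes_inj by blast
  have "S \<subseteq> {..<n}" using permutes_image[OF p(1)] n unfolding S_def by auto
  moreover have "S \<noteq> {}" using B by (auto simp: S_def)
  moreover have "S \<noteq> {..<n}"
  proof
    assume "S = {..<n}"
    moreover have "card S = k" unfolding S_def using inj by (simp add: card_image inj_on_subset)
    ultimately show False using n \<open>dim_row E > 0\<close> by simp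
  qed
  ultimately obtain a a' where a: "a \<in> S" "a' \<in> {..<n} - S" "G $$ (a, a') \<noteq> 0" using S by blast
  obtain i where i: "i < k" "a = p i" using a(1) by (auto simp: S_def)
  have "a' \<in> p ` {..<n}" using a(2) permutes_image[OF p(1)] by auto
  then obtain j where j: "j < n" "a' = p j" by auto
  have "j \<ge> k" using a(2) j by (auto simp: S_def not_less[symmetric])
  have "permute_mat p G $$ (i, j) = 0" unfolding blk using i j n B E \<open>j \<ge> k\<close> by simp
  moreover have "permute_mat p G $$ (i, j) = G $$ (p i, p j)" using i j n G by (simp add: permute_mat_def)
  ultimately show False using a(3) i j by simp
qed

context quadratic_order
begin

text \<open>The bound on the form limits the new entries: each row of the bordered matrix has square
  norm at most 4, so its integral entries are labels. The nonzero \<open>b v\<close> joins the new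
  vertex to the old graph.\<close>

lemma extension_not_maximal:
  assumes sub: "ord \<subseteq> quadratic_integers d" and L: "L_graph d G" and dim: "dim_row G = n"
    and b: "\<And>i. i < n \<Longrightarrow> b i \<in> ord" and v: "v < n" "b v \<noteq> 0" and c: "c \<in> \<int>"
    and F: "form_bounded (Suc n) (bordered n (entry G) b (of_real c))"
  shows "\<not> maximal_graph d G"
proof
  assume max: "maximal_graph d G"
  then have con: "connected_graph G" by (simp add: maximal_graph_def)
  have G: "G \<in> carrier_mat n n" using L dim by (auto simp: L_graph_def)
  define M where "M = bordered n (entry G) b (of_real c)"
  define G' where "G' = mat (Suc n) (Suc n) (\<lambda>(i, j). M i j)"
  have G': "G' \<in> carrier_mat (Suc n) (Suc n)" by (simp add: G'_def)
  have HG: "hermitian_on n (entry G)" using L adjoint_entry[OF G] by (simp add: L_graph_def)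
  have HM: "hermitian_on (Suc n) M" unfolding M_def by (rule hermitian_bordered[OF HG])
  have M: "M i j = entry G' i j" if "i < Suc n" "j < Suc n" for i j
    using that by (simp add: entry_def G'_def)
  have HG': "hermitian_on (Suc n) (entry G')" 
    unfolding hermitian_on_def using hermitian_onD[OF HM] M by metis
  have apM: "ap (Suc n) (entry G') y i = ap (Suc n) M y i" if "i < Suc n" for i y
    unfolding ap_def using M that by (intro sum.cong) auto
  have FG': "form_bounded (Suc n) (entry G')"
  proof -
    have "ip (Suc n) y (ap (Suc n) (entry G') y) = ip (Suc n) y (ap (Suc n) M y)" for y
      by (rule ip_cong) (simp_all add: apM)
    then show ?thesis using F by (simp add: form_bounded_def M_def)
  qed
  have label: "x \<in> edge_labels d" if x: "x \<in> ord" "(cmod x)\<^sup>2 \<le> 4" for x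
  proof -
    obtain k where k: "x * cnj x = of_nat k" "(cmod x)\<^sup>2 = real k" using ord_norm_nat x(1) by blast
    then have "k \<le> 4" using x(2) by simp
    then have "k = 0 \<or> k = 1 \<or> k = 2 \<or> k = 3 \<or> k = 4" by linarith
    moreover have "x \<in> norm_labels d k" using sub x k by (auto simp: norm_labels_def)
    moreover have "x = 0" if "k = 0" using that k by simp
    ultimately show ?thesis by (auto simp: edge_labels_def)
  qed
  have row: "(cmod (M i j))\<^sup>2 \<le> 4" if "i < Suc n" "j < Suc n" for i j
  proof -
    have "(cmod (M i j))\<^sup>2 \<le> (\<Sum>j<Suc n. (cmod (M i j))\<^sup>2)" using that by (intro member_le_sum) auto
    also have "\<dots> \<le> 4" using form_bounded_row[OF HM, of i] F that by (simp add: M_def)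
    finally show ?thesis .
  qed
  have bl: "b i \<in> edge_labels d" if "i < n" for i
    using row[of i n] that b by (intro label) (auto simp: M_def bordered_def)
  have bl': "cnj (b i) \<in> edge_labels d" if "i < n" for i
    using row[of i n] that b ord_cnj by (intro label) (auto simp: M_def bordered_def)
  \<comment> \<open>The entry \<open>b v\<close> has norm at least 1, which leaves at most 3 for
    \<open>c\<^sup>2\<close>.\<close>
  have c3: "c \<in> {0, 1, -1}"
  proof -
    obtain k where k: "(cmod (b v))\<^sup>2 = real k" using ord_norm_nat b v by blast
    then have "k \<noteq> 0" using v(2) by (metis of_nat_0 norm_eq_zero power_eq_0_iff)
    then have 1: "(cmod (b v))\<^sup>2 \<ge> 1" using k by simp
    have "(\<Sum>j<Suc n. (cmod (M n j))\<^sup>2) \<le> 4" using form_bounded_row[OF HM, of n] F by (simp add: M_def)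
    then have "(\<Sum>j<n. (cmod (b j))\<^sup>2) + c\<^sup>2 \<le> 4" by (simp add: M_def bordered_def norm_of_real)
    moreover have "(cmod (b v))\<^sup>2 \<le> (\<Sum>j<n. (cmod (b j))\<^sup>2)" using v by (intro member_le_sum) auto
    ultimately have c2: "c\<^sup>2 \<le> 3" using 1 by linarith
    obtain m where m: "c = of_int m" using c by (auto elim: Ints_cases)
    then have "real_of_int (m\<^sup>2) \<le> real_of_int 3" using c2 by simp
    then have "m\<^sup>2 \<le> 3" using of_int_le_iff by blast
    have "\<bar>m\<bar> < 2"
    proof (rule ccontr)
      assume "\<not> \<bar>m\<bar> < 2"
      then have "2\<^sup>2 \<le> \<bar>m\<bar>\<^sup>2" by (intro power_mono) auto
      then show False using \<open>m\<^sup>2 \<le> 3\<close> by simp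
    qed
    then have "m = 0 \<or> m = 1 \<or> m = -1" by linarith
    then show ?thesis using m by auto
  qed
  have "L_graph d G'"
    unfolding L_graph_def
  proof (intro conjI allI impI)
    show "mat_adjoint G' = G'" using adjoint_entry[OF G'] HG' by simp
    show "G' $$ (i, i) \<in> {0, 1, -1}" if "i < dim_row G'" for i
    proof (cases "i < n")
      case True
      then show ?thesis using L dim by (auto simp: L_graph_def G'_def M_def bordered_def entry_def)
    next
      case False
      then show ?thesis using that c3 by (auto simp: G'_def M_def bordered_def)
    qed
    show "G' $$ (i, j) \<in> edge_labels d" if "i < dim_row G'" "j < dim_row G'" "i \<noteq> j" for i j
    proof -
      have "G $$ (i, j) \<in> edge_labels d" if "i < n" "j < n" using L dim \<open>i \<noteq> j\<close> that by (auto simp: L_graph_def)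
      then show ?thesis using that bl bl' by (auto simp: G'_def M_def bordered_def entry_def)
    qed
  qed (simp add: G'_def)
  moreover have "cyclotomic G'" using cyclotomic_iff_form_bounded[OF G' HG'] FG' by simp
  moreover have "connected_graph G'"
  proof (rule connected_graphI[OF G'])
    fix S assume S: "S \<subseteq> {..<Suc n}" "S \<noteq> {}" "S \<noteq> {..<Suc n}"
    have sym: "G' $$ (j, i) \<noteq> 0 \<longleftrightarrow> G' $$ (i, j) \<noteq> 0" if "i < Suc n" "j < Suc n" for i j
      using hermitian_onD[OF HG' that] by (metis complex_cnj_zero_iff entry_def)
    define T where "T = S \<inter> {..<n}"
    show "\<exists>i\<in>S. \<exists>j\<in>{..<Suc n} - S. G' $$ (i, j) \<noteq> 0"
    \<comment> \<open>A cut that separates no two old vertices separates \<open>n\<close> from all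
      of them and is crossed by the edge between \<open>v\<close> and \<open>n\<close>; any other
      cut is crossed by an old edge.\<close>
    proof (cases "T = {} \<or> T = {..<n}")
      case True
      have "G' $$ (v, n) \<noteq> 0" "G' $$ (n, v) \<noteq> 0" using v by (auto simp: G'_def M_def bordered_def)
      moreover have "(v \<in> S \<and> n \<notin> S) \<or> (v \<notin> S \<and> n \<in> S)"
        using True S v(1) by (auto simp: T_def lessThan_Suc)
      ultimately show ?thesis using v(1) by fastforce
    next
      case False
      then obtain i j where ij: "i \<in> T" "j \<in> {..<n} - T" "G $$ (i, j) \<noteq> 0 \<or> G $$ (j, i) \<noteq> 0"
        using connected_graph_no_cut[OF G con, of T] unfolding T_def by blast
      then have lt: "i < n" "j < n" by (auto simp: T_def)
      then have "G' $$ (i, j) = G $$ (i, j)" "G' $$ (j, i) = G $$ (j, i)"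
        by (auto simp: G'_def M_def bordered_def entry_def)
      then have "G' $$ (i, j) \<noteq> 0" using ij(3) sym[of i j] lt by auto
      moreover have "i \<in> S" "j \<in> {..<Suc n} - S" using ij lt by (auto simp: T_def)
      ultimately show ?thesis by blast
    qed
  qed
  moreover have "dim_row G < dim_row G'" by (simp add: dim G'_def)
  moreover have "contained_in G G'"
    unfolding contained_in_def
  proof (intro exI conjI)
    show "{..<n} \<subseteq> {..<dim_row G'}" by (simp add: G'_def)
    have "{i. i < Suc n \<and> i < n} = {..<n}" by auto
    then have card: "card {i. i < Suc n \<and> i < n} = n" by simp
    have pick: "pick {..<n} i = i" if "i < n" for i
      using that
    proof (induction i)
      case 0
      then show ?case by (auto intro!: Least_equality)
    next
      case (Suc i)
      then show ?case by (auto intro!: Least_equality)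
    qed
    have "submatrix G' {..<n} {..<n} = G"
      using G by (intro eq_matI)
        (auto simp: submatrix_def G'_def card pick M_def bordered_def entry_def)
    moreover have "permute_mat id G = G" by (auto simp: permute_mat_def)
    ultimately show "permutation_similar (submatrix G' {..<n} {..<n}) G"
      unfolding permutation_similar_def using permutes_id by metis
  qed
  ultimately show False using max unfolding maximal_graph_def by blast
qed

end

section \<open>Bordering by an integral column\<close>

text \<open>For both signs \<open>e\<close> the semidefinite \<open>2 + eA\<close> divides
  \<open>D = (2 + eA)(2 - eA)\<close>. So \<open>g = 2y - eAy\<close> is a preimage of
  \<open>b = Dy\<close> under \<open>2 + eA\<close>, and the form of \<open>2 + eA\<close> at
  \<open>z + etg\<close> completes the square in the cross term without an inverse, which need not
  exist. What is left over is \<open>|t|\<^sup>2 (2 - 2s + e(c + \<kappa>))\<close>, and the bound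
  on \<open>c\<close> makes it nonnegative for both signs.\<close>

lemma form_bounded_bordered:
  fixes A y b n
  defines "s \<equiv> Re (ip n y b)" and "\<kappa> \<equiv> Re (ip n (ap n A y) b)"
  assumes H: "hermitian_on n A" and F: "form_bounded n A"
    and b: "\<And>i. i < n \<Longrightarrow> b i = 4 * y i - ap n A (ap n A y) i"
    and c: "\<bar>c + \<kappa>\<bar> \<le> 2 * (1 - s)"
  shows "form_bounded (Suc n) (bordered n A b (of_real c))"
proof (rule form_bounded_borderedI)
  fix z t
  define f where "f = Re (ip n z (ap n A z)) + 2 * Re (t * ip n z b) + c * (cmod t)\<^sup>2"
  define N where "N = 2 * Re (ip n z z) + 2 * (cmod t)\<^sup>2"
  have main: "0 \<le> N + e * f" if e: "e = 1 \<or> e = -1" for e :: real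
  proof -
    define E where "E = complex_of_real e"
    have E: "E * E = 1" "cnj E = E" using e by (auto simp: E_def)
    define g where "g = (\<lambda>i. 2 * y i - E * ap n A y i)"
    define B where "B x z = 2 * ip n x z + E * ip n x (ap n A z)" for x z
    have Bg: "B x g = ip n x b" for x
    proof -
      have "B x g = ip n x (\<lambda>i. 2 * g i + E * ap n A g i)" by (simp only: B_def ip_ap_simps)
      also have "\<dots> = ip n x b"
      proof (rule ip_cong)
        fix i assume "i < n"
        have "2 * g i + E * ap n A g i = 4 * y i - (E * E) * ap n A (ap n A y) i"
          unfolding g_def ip_ap_simps by (simp add: algebra_simps)
        then show "2 * g i + E * ap n A g i = b i" using b[OF \<open>i < n\<close>] E by simp
      qed simp
      finally show ?thesis .
    qed
    have cB: "cnj (B x z) = B z x" for x z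
      by (simp add: B_def cnj_ip ip_adjoint[OF H] E)
    define k where "k = E * t"
    define x where "x = (\<lambda>i. z i + k * g i)"
    have "B x x = B z z + k * B z g + cnj k * B g z + (k * cnj k) * B g g"
      unfolding B_def x_def ip_ap_simps by (simp add: algebra_simps)
    also have "cnj k * B g z = cnj (k * B z g)" by (simp add: cB)
    also have "k * cnj k = (E * E) * (t * cnj t)" by (simp add: k_def E algebra_simps)
    also have "\<dots> = of_real ((cmod t)\<^sup>2)" unfolding E complex_norm_square by simp
    also have "B g g = 2 * ip n y b - E * ip n (ap n A y) b"
      unfolding Bg unfolding g_def ip_ap_simps by (simp add: E)
    finally have "B x x = B z z + (k * ip n z b + cnj (k * ip n z b))
        + of_real ((cmod t)\<^sup>2) * (2 * ip n y b - E * ip n (ap n A y) b)" by (simp only: Bg add.assoc)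
    then have "Re (B x x) = Re (B z z + (k * ip n z b + cnj (k * ip n z b))
        + of_real ((cmod t)\<^sup>2) * (2 * ip n y b - E * ip n (ap n A y) b))" by simp
    then have Bx: "Re (B x x) = 2 * Re (ip n z z) + e * Re (ip n z (ap n A z)) + 2 * (e * Re (t * ip n z b))
        + (cmod t)\<^sup>2 * (2 * s - e * \<kappa>)"
      by (simp add: B_def k_def E_def s_def \<kappa>_def algebra_simps)
    have "0 \<le> Re (B x x)"
    proof -
      have "Re (B x x) = 2 * Re (ip n x x) + e * Re (ip n x (ap n A x))" by (simp add: B_def E_def)
      moreover have "\<bar>Re (ip n x (ap n A x))\<bar> \<le> 2 * Re (ip n x x)" using F by (simp add: form_bounded_def)
      ultimately show ?thesis using e by auto
    qed
    moreover have "0 \<le> (cmod t)\<^sup>2 * (2 - 2 * s + e * (c + \<kappa>))"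
    proof -
      have "0 \<le> 2 * (1 - s) + e * (c + \<kappa>)" using c e by auto
      then have "0 \<le> 2 - 2 * s + e * (c + \<kappa>)" by (simp add: algebra_simps)
      then show ?thesis by simp
    qed
    moreover have "N + e * f = Re (B x x) + (cmod t)\<^sup>2 * (2 - 2 * s + e * (c + \<kappa>))"
      unfolding Bx N_def f_def by (simp add: algebra_simps)
    ultimately show ?thesis by simp
  qed
  show "\<bar>Re (ip n z (ap n A z)) + 2 * Re (t * ip n z b) + c * (cmod t)\<^sup>2\<bar> \<le> 2 * Re (ip n z z) + 2 * (cmod t)\<^sup>2"
    using main[of 1] main[of "-1"] unfolding f_def[symmetric] N_def[symmetric] by simp
qed

locale label_matrix = quadratic_order +
  fixes n :: nat and A :: "nat \<Rightarrow> nat \<Rightarrow> complex"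
  assumes herm: "hermitian_on n A"
    and bounded: "form_bounded n A"
    and entry_ord: "i < n \<Longrightarrow> j < n \<Longrightarrow> A i j \<in> ord"
    and diag: "i < n \<Longrightarrow> A i i \<in> {0, 1, -1}"
begin

definition extendable :: bool where
  "extendable \<longleftrightarrow> (\<exists>b v c. (\<forall>i<n. b i \<in> ord) \<and> v < n \<and> b v \<noteq> 0 \<and> c \<in> \<int> \<and>
     form_bounded (Suc n) (bordered n A b (of_real c)))"

lemma extendableI:
  assumes "\<And>i. i < n \<Longrightarrow> b i \<in> ord" "v < n" "b v \<noteq> 0" "c \<in> \<int>"
    "form_bounded (Suc n) (bordered n A b (of_real c))"
  shows extendable
  unfolding extendable_def using assms by blast

lemma extendable_eigenvector:
  fixes \<mu> :: real
  assumes z: "\<And>i. i < n \<Longrightarrow> z i \<in> ord" and v: "v < n" "z v \<noteq> 0" and mu: "\<mu> > 0"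
    and ev: "\<And>i. i < n \<Longrightarrow> ap n A (ap n A z) i = of_real (4 - \<mu>) * z i"
    and nrm: "4 * Re (ip n z z) \<le> 3 * \<mu>"
  shows extendable
proof -
  define y where "y = (\<lambda>i. of_real (1 / \<mu>) * z i)"
  define \<kappa> where "\<kappa> = Re (ip n (ap n A y) z)"
  define c where "c = - real_of_int (round \<kappa>)"
  \<comment> \<open>At the value 3/4 the admissible distance of \<open>c\<close> from
    \<open>-\<kappa>\<close> is 1/2, the worst error of rounding.\<close>
  have s: "Re (ip n y z) \<le> 3 / 4"
  proof -
    have "Re (ip n y z) = Re (ip n z z) / \<mu>" unfolding y_def ip_ap_simps by simp
    then show ?thesis using nrm mu by (simp add: pos_divide_le_eq)
  qed
  have "\<bar>c + \<kappa>\<bar> \<le> 1 / 2" unfolding c_def using of_int_round_abs_le[of \<kappa>] by (simp add: abs_minus_commute)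
  also have "1 / 2 \<le> 2 * (1 - Re (ip n y z))" using s by argo
  finally have c: "\<bar>c + \<kappa>\<bar> \<le> 2 * (1 - Re (ip n y z))" .
  have "form_bounded (Suc n) (bordered n A z (of_real c))"
  proof (rule form_bounded_bordered[OF herm bounded])
    show "z i = 4 * y i - ap n A (ap n A y) i" if "i < n" for i
      unfolding y_def ip_ap_simps ev[OF that] using mu by (simp add: field_simps)
  qed (use c in \<open>simp add: \<kappa>_def\<close>)
  then show ?thesis using z v by (intro extendableI[of z v c]) (auto simp: c_def)
qed

text \<open>Since \<open>A\<^sup>2y = Ae\<^sub>w\<close>, the column is
  \<open>4y - Ae\<^sub>w\<close> and \<open>y\<^sup>*Dy = 1\<close>, so the charge has to be exactly
  \<open>-\<kappa>\<close>. Here \<open>\<kappa>\<close> is the entry of the column at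
  \<open>w\<close>, which is \<open>-A w w\<close> because \<open>y w = 0\<close>: the new vertex
  inherits the charge of \<open>w\<close>.\<close>

lemma extendable_flip:
  assumes w: "w < n" and y: "\<And>i. i < n \<Longrightarrow> ap n A y i = delta w i" and nrm: "Re (ip n y y) = 1 / 2"
    and yw: "y w = 0" and y_ord: "\<And>i. i < n \<Longrightarrow> 4 * y i \<in> ord"
  shows extendable
proof -
  define b where "b = (\<lambda>i. 4 * y i - A i w)"
  have AA: "ap n A (ap n A y) = (\<lambda>i. A i w)"
    using ap_cong[of n "ap n A y" "delta w" A] y ap_delta[OF w] by simp
  have "ip n y (\<lambda>i. A i w) = ip n (ap n A y) (delta w)"
    unfolding ap_delta[OF w, symmetric] ip_adjoint[OF herm] ..
  also have "\<dots> = ip n (delta w) (delta w)" using y by (intro ip_cong) auto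
  also have "\<dots> = 1" using w by (simp add: ip_delta_left delta_simps)
  finally have "ip n y b = 4 * ip n y y - 1" unfolding b_def ip_ap_simps by simp
  then have s: "Re (ip n y b) = 1" using nrm by simp
  have "ip n (ap n A y) b = ip n (delta w) b" using y by (intro ip_cong) auto
  also have "\<dots> = - A w w" using w yw by (simp add: ip_delta_left b_def)
  finally have k: "Re (ip n (ap n A y) b) = - Re (A w w)" by simp
  have "form_bounded (Suc n) (bordered n A b (of_real (Re (A w w))))"
    by (rule form_bounded_bordered[OF herm bounded, where y = y])
      (simp add: b_def AA, simp add: s k)
  moreover have "\<exists>v<n. b v \<noteq> 0"
  proof (rule ccontr)
    assume "\<not> ?thesis"
    then have "ip n y b = 0" by (simp add: ip_def)
    then show False using s by simp
  qed
  moreover have "Re (A w w) \<in> \<int>" using diag[OF w] by auto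
  moreover have "b i \<in> ord" if "i < n" for i
    unfolding b_def using y_ord entry_ord that w by (intro ord_diff) auto
  ultimately show ?thesis using extendableI by blast
qed

section \<open>Weights, degrees and the first extensions\<close>

definition sq :: "nat \<Rightarrow> nat \<Rightarrow> complex" where
  "sq i j = (\<Sum>k<n. A i k * A k j)"

lemma ap_ap_delta: "j < n \<Longrightarrow> ap n A (ap n A (delta j)) i = sq i j"
  by (simp add: ap_delta) (simp add: ap_def sq_def)

lemma A_sym: "i < n \<Longrightarrow> j < n \<Longrightarrow> cnj (A i j) = A j i"
  by (rule hermitian_onD[OF herm])

lemma sq_diag: "i < n \<Longrightarrow> sq i i = of_real (\<Sum>j<n. (cmod (A i j))\<^sup>2)"
  unfolding sq_def of_real_sum complex_norm_square by (intro sum.cong) (simp_all add: A_sym)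

text \<open>The floor is exact for indices below \<open>n\<close>, as square norms in the order are
  natural numbers. Degrees thus become natural numbers, with a charge counted as a loop of weight
  1.\<close>

definition wt :: "nat \<Rightarrow> nat \<Rightarrow> nat" where
  "wt i j = nat \<lfloor>(cmod (A i j))\<^sup>2\<rfloor>"

definition dg :: "nat \<Rightarrow> nat" where
  "dg i = (\<Sum>j<n. wt i j)"

lemma wt: 
  assumes "i < n" "j < n"
  shows "(cmod (A i j))\<^sup>2 = real (wt i j)"
proof -
  obtain k where "(cmod (A i j))\<^sup>2 = real k" using ord_norm_nat entry_ord assms by blast
  then show ?thesis by (simp add: wt_def)
qed

lemma dg: "i < n \<Longrightarrow> (\<Sum>j<n. (cmod (A i j))\<^sup>2) = real (dg i)"
  by (simp add: dg_def wt)

lemma sq_diag_dg: "i < n \<Longrightarrow> sq i i = of_nat (dg i)"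
  by (simp add: sq_diag dg)

lemma wt_0_iff: "i < n \<Longrightarrow> j < n \<Longrightarrow> wt i j = 0 \<longleftrightarrow> A i j = 0"
  using wt[of i j] by auto

lemma wt_1_iff:
  assumes "i < n" "j < n"
  shows "wt i j = 1 \<longleftrightarrow> A i j = 1 \<or> A i j = -1"
proof
  assume "wt i j = 1"
  then have "(cmod (A i j))\<^sup>2 = 1" using wt assms by simp
  then have "cmod (A i j) = 1" by (simp add: power2_eq_1_iff) (smt (verit) norm_ge_zero)
  then show "A i j = 1 \<or> A i j = -1" using ord_norm_one entry_ord assms by blast
next
  assume "A i j = 1 \<or> A i j = -1"
  then have "(cmod (A i j))\<^sup>2 = 1" by auto
  then show "wt i j = 1" using wt assms by simp
qed

lemma wt_sym: "i < n \<Longrightarrow> j < n \<Longrightarrow> wt i j = wt j i"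
  unfolding wt_def by (metis A_sym complex_mod_cnj)

lemma dg_le_4: "i < n \<Longrightarrow> dg i \<le> 4"
  using form_bounded_row[OF herm bounded, of i] dg[of i] by simp

lemma wt_le_dg: "j < n \<Longrightarrow> wt i j \<le> dg i"
  unfolding dg_def by (rule member_le_sum) auto

lemma wt_sum_le_dg: "S \<subseteq> {..<n} \<Longrightarrow> (\<Sum>j\<in>S. wt i j) \<le> dg i"
  unfolding dg_def by (rule sum_mono2) auto

lemma wt_diag_le_1: "i < n \<Longrightarrow> wt i i \<le> 1"
  using diag[of i] wt_0_iff[of i i] wt_1_iff[of i i] by fastforce

text \<open>For \<open>y = e\<^sub>v\<close> the form is \<open>4 - 3 = 1\<close>, so the charge is
  forced to be \<open>-K\<close>. It is an integer because \<open>K\<close> is real and lies in the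
  order, whose real elements are integers.\<close>

lemma extendable_dg_3:
  assumes v: "v < n" and d3: "dg v = 3"
  shows extendable
proof -
  define b where "b = (\<lambda>i. 4 * delta v i - sq i v)"
  define y where "y = ap n A (delta v)"
  have y: "y = (\<lambda>i. A i v)" by (simp add: y_def ap_delta v)
  have bb: "b = (\<lambda>i. 4 * delta v i - ap n A y i)" unfolding y_def by (simp add: b_def ap_ap_delta v)
  have bv: "b v = 1" using v d3 by (simp add: b_def delta_simps sq_diag_dg)
  have b_ord: "b i \<in> ord" if "i < n" for i
  proof -
    have "4 * delta v i \<in> ord" using ord_int[of 4] ord_0 by (simp add: delta_def)
    moreover have "sq i v \<in> ord" unfolding sq_def
      using that v by (intro ord_sum ord_mult entry_ord) auto
    ultimately show ?thesis unfolding b_def by (rule ord_diff)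
  qed
  define K where "K = ip n y b"
  have "K \<in> ord" unfolding K_def ip_def y
    using b_ord v by (intro ord_sum ord_mult ord_cnj entry_ord) auto
  moreover have "K \<in> \<real>"
  proof -
    have "K = 4 * ip n y (delta v) - ip n y (ap n A y)" unfolding K_def bb ip_ap_simps ..
    moreover have "ip n y (ap n A y) \<in> \<real>" using ip_ap_real[OF herm, of y] by (metis Reals_of_real)
    moreover have "ip n y (delta v) = ip n (delta v) (ap n A (delta v))" unfolding y_def by (rule ip_adjoint[OF herm])
    moreover have "\<dots> \<in> \<real>" using ip_ap_real[OF herm, of "delta v"] by (metis Reals_of_real)
    ultimately show ?thesis by simp
  qed
  ultimately have "K \<in> \<int>" by (rule ord_real_int)
  then have Kint: "- Re K \<in> \<int>" by (auto elim!: Ints_cases)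
  have "form_bounded (Suc n) (bordered n A b (of_real (- Re K)))"
    by (rule form_bounded_bordered[OF herm bounded, where y = "delta v"])
       (simp_all add: y_def[symmetric] K_def[symmetric] ip_delta_left v bv, simp add: bb)
  then show ?thesis using b_ord v bv Kint by (intro extendableI[of b v "- Re K"]) auto
qed

text \<open>The edge to \<open>w\<close> uses up the degree of \<open>v\<close>, so \<open>A\<close>
  maps \<open>e\<^sub>v\<close> to a multiple of \<open>e\<^sub>w\<close>. The resulting column is
  that of \<open>w\<close> with the sign reversed everywhere except at \<open>v\<close>.\<close>

lemma extendable_weight_2:
  assumes v: "v < n" and d2: "dg v = 2" and w: "w < n" "wt v w = 2"
  shows extendable
proof -
  have vw: "v \<noteq> w" using wt_diag_le_1[OF v] w by auto
  have cm: "(cmod (A w v))\<^sup>2 = 2" using wt[OF w(1) v] wt_sym[OF v w(1)] w by simp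
  then have nz: "A w v \<noteq> 0" by auto
  have nn: "A w v * cnj (A w v) = 2" using complex_norm_square[of "A w v"] cm by simp
  have zero: "A k v = 0" if "k < n" "k \<noteq> w" for k
  proof -
    have "(\<Sum>j\<in>{w, k}. wt v j) \<le> 2" using wt_sum_le_dg[of "{w, k}" v] w that d2 by simp
    then have "wt v k = 0" using that w by simp
    then show ?thesis using wt_0_iff[of k v] wt_sym[of v k] that v by simp
  qed
  define y where "y = (\<lambda>i. (1 / A w v) * delta v i)"
  show ?thesis
  proof (rule extendable_flip[OF w(1)])
    show "ap n A y i = delta w i" if "i < n" for i
      unfolding y_def ip_ap_simps ap_delta[OF v] using zero[OF that] nz by (simp add: delta_def)
    show "Re (ip n y y) = 1 / 2"
    proof -
      have "ip n y y = (1 / (A w v * cnj (A w v)))"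
        unfolding y_def ip_ap_simps by (simp add: ip_delta_left v delta_simps)
      then have "ip n y y = of_real (1 / 2)" unfolding nn by simp
      then show ?thesis by (simp only: Re_complex_of_real)
    qed
    show "y w = 0" using vw by (simp add: y_def delta_simps)
    show "4 * y i \<in> ord" if "i < n" for i
    proof (cases "i = v")
      case True
      have "4 * y i = 2 * cnj (A w v)"
        using nn nz by (simp add: True y_def delta_simps field_simps)
      moreover have "2 * cnj (A w v) \<in> ord" using ord_int[of 2] v w by (intro ord_mult ord_cnj entry_ord) auto
      ultimately show ?thesis by (simp only:)
    qed (simp add: y_def delta_simps ord_0)
  qed
qed

end

section \<open>Matrices without one-vertex extensions\<close>

lemma sum_two:
  fixes f :: "nat \<Rightarrow> complex"
  assumes "a < n" "b < n" "a \<noteq> b" "\<And>k. k < n \<Longrightarrow> k \<noteq> a \<Longrightarrow> k \<noteq> b \<Longrightarrow> f k = 0"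
  shows "(\<Sum>k<n. f k) = f a + f b"
proof -
  have "(\<Sum>k<n. f k) = (\<Sum>k\<in>{a, b}. f k)"
    using assms by (intro sum.mono_neutral_right) auto
  then show ?thesis using assms by simp
qed

lemma sum_one:
  fixes f :: "nat \<Rightarrow> complex"
  assumes "a < n" "\<And>k. k < n \<Longrightarrow> k \<noteq> a \<Longrightarrow> f k = 0"
  shows "(\<Sum>k<n. f k) = f a"
proof -
  have "(\<Sum>k<n. f k) = (\<Sum>k\<in>{a}. f k)"
    using assms by (intro sum.mono_neutral_right) auto
  then show ?thesis by simp
qed

lemma ip_self_two:
  assumes "a < n" "b < n" "a \<noteq> b" "x = 1 \<or> x = -1" "y = 1 \<or> y = -1"
  shows "ip n (\<lambda>i. x * delta a i - y * delta b i) (\<lambda>i. x * delta a i - y * delta b i) = 2"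
proof -
  have "ip n (\<lambda>i. x * delta a i - y * delta b i) (\<lambda>i. x * delta a i - y * delta b i) = cnj x * x + cnj y * y"
    unfolding ip_ap_simps using assms(1-3) by (simp add: ip_delta_left delta_simps)
  then show ?thesis using assms(4,5) by auto
qed

lemma cmod_add_sq: "(cmod (a + b))\<^sup>2 = (cmod a)\<^sup>2 + (cmod b)\<^sup>2 + 2 * Re (cnj a * b)"
  unfolding cmod_power2 by (simp add: power2_eq_square algebra_simps)

locale nonextendable_matrix = label_matrix +
  assumes not_extendable: "\<not> extendable"
begin

lemma dg_cases:
  assumes "i < n"
  shows "dg i \<le> 2 \<or> dg i = 4"
proof -
  have "dg i \<noteq> 3" using extendable_dg_3 assms not_extendable by blast
  then show ?thesis using dg_le_4[OF assms] by linarith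
qed

lemma low_wt_le_1:
  assumes "v < n" "w < n" "dg v \<le> 2"
  shows "wt v w \<le> 1"
proof (rule ccontr)
  assume "\<not> ?thesis"
  then have "wt v w = 2" "dg v = 2" using wt_le_dg[of w v] assms by auto
  then show False using extendable_weight_2 assms not_extendable by blast
qed

lemma low_entry:
  assumes "v < n" "w < n" "dg v \<le> 2" "A v w \<noteq> 0"
  shows "A v w = 1 \<or> A v w = -1" "A w v = A v w" "wt v w = 1"
proof -
  have "wt v w \<noteq> 0" using wt_0_iff assms by blast
  then show 1: "wt v w = 1" using low_wt_le_1[of v w] assms by simp
  then show 2: "A v w = 1 \<or> A v w = -1" using wt_1_iff assms by blast
  then show "A w v = A v w" using A_sym[of v w] assms by auto
qed

text \<open>After \<open>u\<close> only weight 1 remains, hence a single entry. It may be the charge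
  of \<open>v\<close>, in which case \<open>w = v\<close>.\<close>

lemma low_other:
  assumes v: "v < n" and u: "u < n" and d: "dg v = 2" and uv: "A v u \<noteq> 0"
  obtains w where "w < n" "w \<noteq> u" "A v w \<noteq> 0" "\<And>k. k < n \<Longrightarrow> k \<noteq> u \<Longrightarrow> k \<noteq> w \<Longrightarrow> A v k = 0"
proof -
  have "dg v = wt v u + (\<Sum>k\<in>{..<n} - {u}. wt v k)"
    unfolding dg_def using u by (subst sum.remove[of _ u]) auto
  then have "(\<Sum>k\<in>{..<n} - {u}. wt v k) = 1" using low_entry(3)[OF v u _ uv] d by simp
  then obtain w where w: "w \<in> {..<n} - {u}" "wt v w = 1" "\<And>k. k \<in> {..<n} - {u} \<Longrightarrow> w \<noteq> k \<Longrightarrow> wt v k = 0"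
    using sum_eq_1_iff[of "{..<n} - {u}" "wt v"] by auto
  show ?thesis
  proof (rule that[of w])
    show "A v w \<noteq> 0" using w wt_0_iff[of v w] v by auto
    show "A v k = 0" if "k < n" "k \<noteq> u" "k \<noteq> w" for k
      using w(3)[of k] that wt_0_iff[of v k] v by auto
  qed (use w in auto)
qed

lemma leaf_row:
  assumes v: "v < n" and u: "u < n" and d: "dg v = 1" and uv: "A v u \<noteq> 0" and k: "k < n" "k \<noteq> u"
  shows "A v k = 0"
proof -
  have "(\<Sum>j\<in>{u, k}. wt v j) \<le> 1" using wt_sum_le_dg[of "{u, k}" v] u k d by simp
  then have "wt v k = 0" using low_entry(3)[OF v u _ uv] d k by simp
  then show ?thesis using wt_0_iff v k by blast
qed

lemma unit_delta_ord: "x = 1 \<or> x = -1 \<Longrightarrow> x * delta a i \<in> ord"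
  using ord_0 ord_1 ord_minus[OF ord_1] by (auto simp: delta_def)

text \<open>The signed difference of \<open>e\<^sub>j\<close> and \<open>e\<^sub>v\<close> lies in
  the kernel of \<open>A\<close>, so \<open>D\<close> acts on it as 4, and its square norm 2 meets
  the bound: \<open>4 * 2 \<le> 3 * 4\<close>.\<close>

lemma no_equal_columns:
  assumes jv: "j < n" "v < n" "j \<noteq> v" and xy: "x = 1 \<or> x = -1" "y = 1 \<or> y = -1"
    and eq: "\<And>k. k < n \<Longrightarrow> x * A k j = y * A k v"
  shows False
proof -
  define z where "z = (\<lambda>i. x * delta j i - y * delta v i)"
  have Az: "ap n A z k = 0" if "k < n" for k
    unfolding z_def ip_ap_simps using eq[OF that] jv by (simp add: ap_delta)
  have AAz: "ap n A (ap n A z) i = 0" for i using Az by (simp add: ap_def[of n A "ap n A z"])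
  have extendable
  proof (rule extendable_eigenvector[of z j 4])
    show "z i \<in> ord" for i unfolding z_def using xy by (intro ord_diff unit_delta_ord)
    show "z j \<noteq> 0" using jv xy by (auto simp: z_def delta_simps)
    show "4 * Re (ip n z z) \<le> 3 * 4" unfolding z_def using ip_self_two[OF jv xy] by simp
  qed (use jv AAz in auto)
  then show False using not_extendable by simp
qed

text \<open>The signed sum of the two columns is \<open>2e\<^sub>u\<close>, so half the
  corresponding vector is mapped to \<open>e\<^sub>u\<close> and has square norm 1/2, as a flip at
  \<open>u\<close> requires.\<close>

lemma no_opposite_columns:
  assumes jv: "j < n" "v < n" "j \<noteq> v" and u: "u < n" "u \<noteq> j" "u \<noteq> v"
    and xy: "A u j = 1 \<or> A u j = -1" "A u v = 1 \<or> A u v = -1"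
    and eq: "\<And>k. k < n \<Longrightarrow> k \<noteq> u \<Longrightarrow> A u j * A k j = - (A u v * A k v)"
  shows False
proof -
  define z where "z = (\<lambda>i. A u j * delta j i - (- A u v) * delta v i)"
  define y where "y = (\<lambda>i. (1/2) * z i)"
  have zz: "ip n z z = 2" unfolding z_def using xy by (intro ip_self_two[OF jv]) auto
  have extendable
  proof (rule extendable_flip[OF u(1), of y])
    show "ap n A y k = delta u k" if "k < n" for k
    proof -
      have "ap n A z k = A u j * A k j + A u v * A k v"
        unfolding z_def ip_ap_simps using jv by (simp add: ap_delta)
      also have "\<dots> = 2 * delta u k"
        using eq[OF that] xy by (cases "k = u") (auto simp: delta_simps)
      finally show ?thesis unfolding y_def ip_ap_simps by simp
    qed
    have "ip n y y = of_real (1 / 2)" unfolding y_def ip_ap_simps zz by simp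
    then show "Re (ip n y y) = 1 / 2" by (simp only: Re_complex_of_real)
    show "y u = 0" using u by (simp add: y_def z_def delta_simps)
    show "4 * y i \<in> ord" for i
    proof -
      have "z i \<in> ord" unfolding z_def using xy by (intro ord_diff unit_delta_ord) auto
      then have "2 * z i \<in> ord" using ord_int[of 2] by (intro ord_mult) auto
      then show ?thesis by (simp add: y_def)
    qed
  qed
  then show False using not_extendable by simp
qed

section \<open>Low neighbours of a vertex of degree 4\<close>

lemma sq_dg_4:
  assumes "u < n" "dg u = 4" "j < n"
  shows "sq j u = (if j = u then 4 else 0)" "sq u j = (if j = u then 4 else 0)"
proof -
  \<comment> \<open>Degree 4 means that the diagonal entry of the semidefinite \<open>D\<close> at
    \<open>u\<close> vanishes, and with it the whole column.\<close>
  have "ap n A (ap n A (delta u)) i = 4 * delta u i" if "i < n" for i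
  proof (rule form_bounded_extremal[OF herm bounded _ that])
    have "Re (ip n (ap n A (delta u)) (ap n A (delta u))) = Re (ip n (delta u) (ap n A (ap n A (delta u))))"
      by (simp only: ip_adjoint[OF herm])
    also have "\<dots> = 4" using assms by (simp add: ip_delta_left ap_ap_delta sq_diag_dg)
    finally show "Re (ip n (ap n A (delta u)) (ap n A (delta u))) = 4 * Re (ip n (delta u) (delta u))"
      using assms by (simp add: ip_delta_left delta_simps)
  qed
  then have "sq j u = 4 * delta u j" using assms by (simp add: ap_ap_delta)
  then show 1: "sq j u = (if j = u then 4 else 0)" by (simp add: delta_def)
  have "sq u j = cnj (sq j u)"
    unfolding sq_def using assms by (simp add: A_sym mult.commute)
  then show "sq u j = (if j = u then 4 else 0)" using 1 by simp
qed

definition low_nbrs :: "nat \<Rightarrow> nat set" where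
  "low_nbrs u = {j. j < n \<and> A u j \<noteq> 0 \<and> dg j \<le> 2}"

lemma low_nbrsD:
  assumes "u < n" "j \<in> low_nbrs u"
  shows "j < n" "dg j = 1 \<or> dg j = 2" "A u j = 1 \<or> A u j = -1" "A j u = A u j" "wt u j = 1"
proof -
  show 1: "j < n" using assms by (simp add: low_nbrs_def)
  have "A u j \<noteq> 0" "dg j \<le> 2" using assms by (auto simp: low_nbrs_def)
  then have nz: "A j u \<noteq> 0" using A_sym[of u j] assms 1 by (metis complex_cnj_zero_iff)
  note e = low_entry[OF 1 assms(1) \<open>dg j \<le> 2\<close> nz]
  show "A u j = 1 \<or> A u j = -1" "A j u = A u j" using e by auto
  show "wt u j = 1" using e(3) wt_sym 1 assms(1) by simp
  then have "dg j \<noteq> 0" using wt_le_dg[of u j] e(3) assms by simp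
  then show "dg j = 1 \<or> dg j = 2" using \<open>dg j \<le> 2\<close> by linarith
qed

text \<open>Only the path through \<open>u\<close> joins \<open>j\<close> and \<open>v\<close> in
  two steps. A second common neighbour \<open>w\<close> would exhaust both degrees, so both columns
  would be supported on \<open>u\<close> and \<open>w\<close> with entries
  \<open>\<plusminus>1\<close>. After normalising them at \<open>u\<close> they would be equal or
  opposite at \<open>w\<close>, and both cases are excluded.\<close>

lemma low_nbrs_sq:
  assumes u: "u < n" "dg u = 4" and jv: "j \<in> low_nbrs u" "v \<in> low_nbrs u" "j \<noteq> v"
  shows "sq j v = A u j * A u v"
proof -
  note j = low_nbrsD[OF u(1) jv(1)] and v = low_nbrsD[OF u(1) jv(2)]
  have uj: "u \<noteq> j" "u \<noteq> v" using u(2) j(2) v(2) by auto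
  have Avu: "A v u \<noteq> 0" "A j u \<noteq> 0" using v j by auto
  have col: "A k v = 0 \<longleftrightarrow> A v k = 0" if "k < n" for k
    using A_sym[OF that v(1)] by (metis complex_cnj_zero_iff)
  show ?thesis
  proof (cases "dg v = 1")
    case True
    have "sq j v = A j u * A u v" unfolding sq_def
      using leaf_row[OF v(1) u(1) True Avu(1)] col by (intro sum_one u) auto
    then show ?thesis using j by simp
  next
    case False
    then have d2: "dg v = 2" using v by simp
    obtain w where w: "w < n" "w \<noteq> u" "A v w \<noteq> 0" "\<And>k. k < n \<Longrightarrow> k \<noteq> u \<Longrightarrow> k \<noteq> w \<Longrightarrow> A v k = 0"
      using low_other[OF v(1) u(1) d2 Avu(1)] by blast
    have s: "sq j v = A j u * A u v + A j w * A w v" unfolding sq_def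
      using w col by (intro sum_two u) auto
    have "A j w = 0"
    proof (rule ccontr)
      assume nz: "A j w \<noteq> 0"
      have "dg j \<noteq> 1" using leaf_row[OF j(1) u(1) _ Avu(2), of w] w nz by auto
      then have jd: "dg j = 2" using j by simp
      obtain w' where w': "w' < n" "w' \<noteq> u" "\<And>k. k < n \<Longrightarrow> k \<noteq> u \<Longrightarrow> k \<noteq> w' \<Longrightarrow> A j k = 0"
        using low_other[OF j(1) u(1) jd Avu(2)] by blast
      then have "w' = w" using nz w by metis
      then have j0: "A k j = 0" if "k < n" "k \<noteq> u" "k \<noteq> w" for k
        using w'(3)[of k] that A_sym[of j k] j(1) by auto
      have v0: "A k v = 0" if "k < n" "k \<noteq> u" "k \<noteq> w" for k using w(4)[of k] that col by auto
      have jw: "A w j = 1 \<or> A w j = -1" using low_entry[OF j(1) w(1) _ nz] jd by auto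
      have vw: "A w v = 1 \<or> A w v = -1" using low_entry[OF v(1) w(1) _ w(3)] d2 by auto
      show False
      proof (cases "A u j * A w j = A u v * A w v")
        case True
        show False
        proof (rule no_equal_columns[OF j(1) v(1) jv(3) j(3) v(3)])
          fix k assume "k < n"
          then show "A u j * A k j = A u v * A k v"
            using True j0[of k] v0[of k] j(3) v(3) by (cases "k = u"; cases "k = w") auto
        qed
      next
        case False
        then have opp: "A u j * A w j = - (A u v * A w v)" using jw vw j(3) v(3) by auto
        show False
        proof (rule no_opposite_columns[OF j(1) v(1) jv(3) u(1) uj j(3) v(3)])
          fix k assume "k < n" "k \<noteq> u"
          then show "A u j * A k j = - (A u v * A k v)"
            using opp j0[of k] v0[of k] by (cases "k = w") auto
        qed
      qed
    qed
    then show ?thesis using s j by simp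
  qed
qed

text \<open>The entry of \<open>A\<^sup>3\<close> at \<open>(u, v)\<close> is computed in two ways.
  Row \<open>u\<close> of \<open>A\<^sup>2\<close> is 4 at \<open>u\<close> and 0 elsewhere, which
  gives \<open>4 * A u v\<close>. In the sum over the neighbours \<open>j\<close> of
  \<open>u\<close>, those of degree 4 contribute 0, each low one other than \<open>v\<close>
  contributes \<open>A u v\<close>, and \<open>v\<close> itself contributes \<open>dg v\<close>
  times this.\<close>

lemma low_nbrs_card:
  assumes u: "u < n" "dg u = 4" and v: "v \<in> low_nbrs u"
  shows "card (low_nbrs u) + dg v = 5"
proof -
  define N where "N = low_nbrs u"
  note vv = low_nbrsD[OF u(1) v]
  have N: "finite N" "N \<subseteq> {..<n}" "v \<in> N" using v by (auto simp: N_def low_nbrs_def)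
  have "(\<Sum>j<n. A u j * sq j v) = (\<Sum>j<n. \<Sum>k<n. A u j * A j k * A k v)"
    by (simp add: sq_def sum_distrib_left mult.assoc)
  also have "\<dots> = (\<Sum>k<n. \<Sum>j<n. A u j * A j k * A k v)" by (rule sum.swap)
  also have "\<dots> = (\<Sum>k<n. sq u k * A k v)" by (simp add: sq_def sum_distrib_right)
  also have "\<dots> = sq u u * A u v" using sq_dg_4(2)[OF u] by (intro sum_one u) auto
  also have "\<dots> = 4 * A u v" using sq_dg_4(2)[OF u u(1)] by simp
  finally have e: "(\<Sum>j<n. A u j * sq j v) = 4 * A u v" .
  have "(\<Sum>j<n. A u j * sq j v) = (\<Sum>j\<in>N. A u j * sq j v)"
  proof (rule sum.mono_neutral_right)
    show "\<forall>j\<in>{..<n} - N. A u j * sq j v = 0"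
    proof
      fix j assume j: "j \<in> {..<n} - N"
      show "A u j * sq j v = 0"
      proof (cases "A u j = 0")
        case False
        then have "dg j = 4" using j dg_cases[of j] by (auto simp: N_def low_nbrs_def)
        then have "sq j v = 0" using sq_dg_4(2)[of j v] j vv N(3) by auto
        then show ?thesis by simp
      qed simp
    qed
  qed (use N in auto)
  also have "\<dots> = A u v * sq v v + (\<Sum>j\<in>N - {v}. A u j * sq j v)" using N by (simp add: sum.remove)
  also have "(\<Sum>j\<in>N - {v}. A u j * sq j v) = (\<Sum>j\<in>N - {v}. A u v)"
  proof (rule sum.cong)
    fix j assume j: "j \<in> N - {v}"
    then have "sq j v = A u j * A u v" using low_nbrs_sq[OF u _ v] by (simp add: N_def)
    then show "A u j * sq j v = A u v" using low_nbrsD(3)[OF u(1), of j] j by (auto simp: N_def)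
  qed simp
  also have "A u v * sq v v = of_nat (dg v) * A u v" by (simp add: sq_diag_dg vv)
  also have "(\<Sum>j\<in>N - {v}. A u v) = of_nat (card N - 1) * A u v" using N by simp
  finally have "of_nat (dg v + (card N - 1)) * A u v = 4 * A u v" using e by (simp add: algebra_simps)
  then have "of_nat (dg v + (card N - 1)) = (of_nat 4 :: complex)" using vv(3) by auto
  then have "dg v + (card N - 1) = 4" by (simp only: of_nat_eq_iff)
  moreover have "card N > 0" using N by (auto simp: card_gt_0_iff)
  ultimately show ?thesis by (simp add: N_def)
qed

text \<open>By the count all low neighbours of \<open>u\<close> have the same degree. If it were 1
  there would be four of them, and two leaves at \<open>u\<close> have columns that agree up to
  sign.\<close>

lemma low_nbrs_dg_2:
  assumes u: "u < n" "dg u = 4" and v: "v \<in> low_nbrs u"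
  shows "dg v = 2" "card (low_nbrs u) = 3"
proof -
  note vv = low_nbrsD[OF u(1) v]
  show "dg v = 2"
  proof (rule ccontr)
    assume "dg v \<noteq> 2"
    then have d1: "dg v = 1" using vv by simp
    then have "card (low_nbrs u) = 4" using low_nbrs_card[OF u v] by simp
    then have "\<not> low_nbrs u \<subseteq> {v}" using card_mono[of "{v}" "low_nbrs u"] by auto
    then obtain j where j: "j \<in> low_nbrs u" "j \<noteq> v" by blast
    note jj = low_nbrsD[OF u(1) j(1)]
    have dj: "dg j = 1" using low_nbrs_card[OF u j(1)] \<open>card (low_nbrs u) = 4\<close> by simp
    show False
    proof (rule no_equal_columns[OF jj(1) vv(1) j(2) jj(3) vv(3)])
      fix k assume k: "k < n"
      show "A u j * A k j = A u v * A k v"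
      proof (cases "k = u")
        case False
        have "A j k = 0" using leaf_row[OF jj(1) u(1) dj _ k False] jj by auto
        moreover have "A v k = 0" using leaf_row[OF vv(1) u(1) d1 _ k False] vv by auto
        ultimately have "A k j = 0" "A k v = 0" using A_sym[OF jj(1) k] A_sym[OF vv(1) k] by auto
        then show ?thesis by simp
      qed (use jj vv in auto)
    qed
  qed
  then show "card (low_nbrs u) = 3" using low_nbrs_card[OF u v] by simp
qed

text \<open>Three low neighbours take weight 3 of the degree 4, so exactly one entry of weight 1
  remains. It may be the charge of \<open>u\<close>, in which case \<open>p = u\<close>.\<close>

lemma fourth_nbr:
  assumes u: "u < n" "dg u = 4" and v: "v \<in> low_nbrs u"
  obtains p where "p < n" "wt u p = 1" "dg p = 4" 
    "\<And>k. k < n \<Longrightarrow> A u k \<noteq> 0 \<Longrightarrow> k \<in> low_nbrs u \<or> k = p"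
proof -
  define N where "N = low_nbrs u"
  have N: "finite N" "N \<subseteq> {..<n}" by (auto simp: N_def low_nbrs_def)
  have "(\<Sum>j\<in>N. wt u j) = 3"
    using low_nbrs_dg_2(2)[OF u v] low_nbrsD(5)[OF u(1)] by (simp add: N_def)
  moreover have "dg u = (\<Sum>j\<in>{..<n} - N. wt u j) + (\<Sum>j\<in>N. wt u j)"
    unfolding dg_def using N by (intro sum.subset_diff) auto
  ultimately have "(\<Sum>j\<in>{..<n} - N. wt u j) = 1" using u(2) by simp
  then obtain p where p: "p \<in> {..<n} - N" "wt u p = 1" "\<And>k. k \<in> {..<n} - N \<Longrightarrow> p \<noteq> k \<Longrightarrow> wt u k = 0"
    using sum_eq_1_iff[of "{..<n} - N" "wt u"] by auto
  show ?thesis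
  proof (rule that[of p])
    show "dg p = 4"
    proof -
      have "A u p \<noteq> 0" using p wt_0_iff[of u p] u by auto
      then show ?thesis using p dg_cases[of p] by (auto simp: N_def low_nbrs_def)
    qed
    show "k \<in> low_nbrs u \<or> k = p" if "k < n" "A u k \<noteq> 0" for k
      using p(3)[of k] that wt_0_iff[of u k] u by (auto simp: N_def)
  qed (use p in auto)
qed

text \<open>Columns \<open>i\<close> and \<open>p\<close> of \<open>A\<close> are orthogonal because
  \<open>p\<close> has degree 4. The only two-step paths between them pass through \<open>u\<close>
  and \<open>w\<close>, so they cancel: \<open>w\<close> is adjacent to \<open>p\<close>, and the
  square \<open>u, i, w, p\<close> is negative, as in the signed cube.\<close>

lemma square_sign:
  assumes u: "u < n" "dg u = 4" and p: "p < n" "dg p = 4" "A u p \<noteq> 0" "p \<notin> low_nbrs u"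
    and i: "i \<in> low_nbrs u" and w: "w < n" "w \<noteq> u" "A i w \<noteq> 0"
  shows "A w p = - (A u i * A i w) * A u p"
proof -
  note ii = low_nbrsD[OF u(1) i]
  have d2: "dg i = 2" using low_nbrs_dg_2[OF u i] by simp
  have iu: "A i u \<noteq> 0" using ii by auto
  obtain w' where w': "w' < n" "w' \<noteq> u" "\<And>k. k < n \<Longrightarrow> k \<noteq> u \<Longrightarrow> k \<noteq> w' \<Longrightarrow> A i k = 0"
    using low_other[OF ii(1) u(1) d2 iu] by blast
  then have "w' = w" using w by metis
  then have "sq i p = A i u * A u p + A i w * A w p" unfolding sq_def
    using w' w by (intro sum_two u) auto
  moreover have "sq i p = 0" using sq_dg_4(1)[OF p(1,2) ii(1)] p i by auto
  ultimately have "A i w * A w p = - (A u i * A u p)" using ii by (simp add: add_eq_0_iff)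
  then have "A i w * (A i w * A w p) = - (A u i * A i w) * A u p" by (simp add: algebra_simps)
  moreover have "A i w * A i w = 1" using low_entry(1)[OF ii(1) w(1) _ w(3)] d2 by auto
  ultimately show ?thesis by (metis mult.assoc mult_1)
qed

text \<open>The path through \<open>u\<close> already accounts for all of \<open>sq i j\<close>,
  which leaves nothing for a second common neighbour.\<close>

lemma distinct_others:
  assumes u: "u < n" "dg u = 4" and ij: "i \<in> low_nbrs u" "j \<in> low_nbrs u" "i \<noteq> j"
    and w: "w < n" "w \<noteq> u" "A i w \<noteq> 0"
  shows "A j w = 0"
proof (rule ccontr)
  assume nz: "A j w \<noteq> 0"
  note ii = low_nbrsD[OF u(1) ij(1)] and jj = low_nbrsD[OF u(1) ij(2)]
  have d2: "dg i = 2" using low_nbrs_dg_2[OF u ij(1)] by simp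
  have iu: "A i u \<noteq> 0" using ii by auto
  obtain w' where w': "w' < n" "w' \<noteq> u" "\<And>k. k < n \<Longrightarrow> k \<noteq> u \<Longrightarrow> k \<noteq> w' \<Longrightarrow> A i k = 0"
    using low_other[OF ii(1) u(1) d2 iu] by blast
  then have "w' = w" using w by metis
  then have "sq i j = A i u * A u j + A i w * A w j" unfolding sq_def
    using w' w by (intro sum_two u) auto
  then have "A i w * A w j = 0" using low_nbrs_sq[OF u ij] ii by simp
  then show False using w nz A_sym[OF w(1) jj(1)] by auto
qed

lemma low_column:
  assumes q: "q < n" "dg q = 2" and u: "u < n" "A q u \<noteq> 0" and y: "y < n" "y \<noteq> u" "A q y \<noteq> 0" and k: "k < n"
  shows "A k q = A q u * delta u k + A q y * delta y k"
proof -
  obtain y' where y': "y' < n" "y' \<noteq> u" "\<And>k. k < n \<Longrightarrow> k \<noteq> u \<Longrightarrow> k \<noteq> y' \<Longrightarrow> A q k = 0"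
    using low_other[OF q(1) u(1) q(2) u(2)] by blast
  then have "y' = y" using y by metis
  moreover have "A y q = A q y" "A u q = A q u" using low_entry(2)[OF q(1)] q(2) y u by auto
  moreover have "A k q = 0" if "A q k = 0" using A_sym[OF q(1) k] that by auto
  ultimately show ?thesis using y' y k by (auto simp: delta_def)
qed

text \<open>The degree of \<open>w\<close> is used up by \<open>i\<close> and \<open>p\<close>, that
  of \<open>x\<close> by \<open>j\<close> and \<open>p\<close>. For \<open>z\<close>, a signed
  difference of \<open>e\<^sub>i\<close> and \<open>e\<^sub>j\<close>, the contributions at
  \<open>u\<close> cancel, so \<open>Az\<close> lives on \<open>w\<close> and \<open>x\<close>.
  Applying \<open>A\<close> again, the contributions at \<open>p\<close> cancel by the signs of the
  two squares, and \<open>z\<close> returns. Thus \<open>Dz = 3z\<close>, and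
  \<open>4 * 2 \<le> 3 * 3\<close>.\<close>

lemma no_two_low_others:
  assumes u: "u < n" "dg u = 4" and p: "p < n" "dg p = 4" "A u p \<noteq> 0" "p \<notin> low_nbrs u"
    and ij: "i \<in> low_nbrs u" "j \<in> low_nbrs u" "i \<noteq> j"
    and w: "w < n" "w \<noteq> u" "A i w \<noteq> 0" "dg w \<le> 2"
    and x: "x < n" "x \<noteq> u" "A j x \<noteq> 0" "dg x \<le> 2"
  shows False
proof -
  note ii = low_nbrsD[OF u(1) ij(1)] and jj = low_nbrsD[OF u(1) ij(2)]
  have d2: "dg i = 2" "dg j = 2" using low_nbrs_dg_2[OF u] ij by auto
  have nz: "A i u \<noteq> 0" "A j u \<noteq> 0" using ii jj by auto
  have col: "A u q * A q y * A k y = A u q * delta q k - A u p * delta p k"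
    if q: "q \<in> low_nbrs u" and y: "y < n" "y \<noteq> u" "A q y \<noteq> 0" "dg y \<le> 2" and k: "k < n" for q y k
  proof -
    note qq = low_nbrsD[OF u(1) q]
    have dq: "dg q = 2" using low_nbrs_dg_2[OF u q] by simp
    have qy: "A q y = 1 \<or> A q y = -1" "A y q = A q y" using low_entry[OF qq(1) y(1) _ y(3)] dq by auto
    have pq: "p \<noteq> q" using p q by auto
    have yp: "A y p = - (A u q * A q y) * A u p" by (rule square_sign[OF u p q y(1-3)])
    then have nz: "A y p \<noteq> 0" "A y q \<noteq> 0" using qq(3) qy p(3) by auto
    have "wt y p = 1" "wt y q = 1" using low_entry(3)[OF y(1) _ y(4)] nz p qq by auto
    then have zero: "A k y = 0" if "k \<noteq> p" "k \<noteq> q"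
    proof -
      have "(\<Sum>l\<in>{p, q, k}. wt y l) \<le> 2" using wt_sum_le_dg[of "{p, q, k}" y] p qq k y(4) by simp
      then have "wt y k = 0" using \<open>wt y p = 1\<close> \<open>wt y q = 1\<close> that pq by auto
      then show ?thesis using wt_0_iff[OF y(1) k] A_sym[OF y(1) k] by auto
    qed
    have py: "A p y = A y p" using low_entry(2)[OF y(1) p(1) y(4) nz(1)] .
    show ?thesis
    proof (cases "k = p")
      case True
      have "A u q * A q y * A p y = - ((A u q * A u q) * (A q y * A q y)) * A u p"
        unfolding py yp by (simp add: algebra_simps)
      also have "\<dots> = - A u p" using qq(3) qy(1) by auto
      finally show ?thesis using True pq by (simp add: delta_simps)
    next
      case False
      show ?thesis
      proof (cases "k = q")
        case True
        then show ?thesis using pq qy by (auto simp: delta_simps)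
      next
        case False
        then show ?thesis using zero \<open>k \<noteq> p\<close> by (simp add: delta_simps)
      qed
    qed
  qed
  define z where "z = (\<lambda>k. A u i * delta i k - A u j * delta j k)"
  have Az: "ap n A z k = (A u i * A i w) * delta w k - (A u j * A j x) * delta x k" if k: "k < n" for k
  proof -
    have "ap n A z k = A u i * A k i - A u j * A k j"
      unfolding z_def ip_ap_simps using ii jj by (simp add: ap_delta)
    also have "\<dots> = (A u i * A u i - A u j * A u j) * delta u k + (A u i * A i w) * delta w k - (A u j * A j x) * delta x k"
      unfolding low_column[OF ii(1) d2(1) u(1) nz(1) w(1-3) k] low_column[OF jj(1) d2(2) u(1) nz(2) x(1-3) k] ii(4) jj(4)
      by (simp add: algebra_simps)
    also have "A u i * A u i - A u j * A u j = 0" using ii(3) jj(3) by auto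
    finally show ?thesis by simp
  qed
  have AAz: "ap n A (ap n A z) k = z k" if k: "k < n" for k
  proof -
    have "ap n A (ap n A z) = ap n A (\<lambda>k. (A u i * A i w) * delta w k - (A u j * A j x) * delta x k)"
      by (rule ap_cong) (rule Az)
    then have "ap n A (ap n A z) k = A u i * A i w * A k w - A u j * A j x * A k x"
      unfolding ip_ap_simps using w x by (simp add: ap_delta)
    also have "\<dots> = z k" unfolding col[OF ij(1) w k] col[OF ij(2) x k] by (simp add: z_def)
    finally show ?thesis .
  qed
  have extendable
  proof (rule extendable_eigenvector[of z i 3])
    show "z k \<in> ord" for k unfolding z_def using ii jj by (intro ord_diff unit_delta_ord) auto
    show "z i \<noteq> 0" using ij ii by (auto simp: z_def delta_simps)
    show "4 * Re (ip n z z) \<le> 3 * 3" unfolding z_def using ip_self_two[OF ii(1) jj(1) ij(3) ii(3) jj(3)] by simp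
  qed (use ii AAz in auto)
  then show False using not_extendable by simp
qed

text \<open>Sending each low neighbour of \<open>u\<close> to its second neighbour is injective,
  since second neighbours are not shared, and lands in \<open>T\<close> by the sign rule for
  squares. There are three low neighbours, so all of \<open>T\<close> is reached.\<close>

lemma others_exhaust:
  assumes u: "u < n" "dg u = 4" and p: "p < n" "dg p = 4" "A u p \<noteq> 0" "p \<notin> low_nbrs u"
    and v: "v \<in> low_nbrs u" and T: "card T = 3" "\<And>w. w < n \<Longrightarrow> w \<noteq> u \<Longrightarrow> A w p \<noteq> 0 \<Longrightarrow> w \<in> T"
    and t: "t \<in> T"
  shows "\<exists>j\<in>low_nbrs u. A j t \<noteq> 0"
proof -
  define N where "N = low_nbrs u"
  have "\<forall>j\<in>N. \<exists>w. w < n \<and> w \<noteq> u \<and> A j w \<noteq> 0"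
  proof
    fix j assume j: "j \<in> N"
    then have j': "j \<in> low_nbrs u" by (simp add: N_def)
    note jj = low_nbrsD[OF u(1) j']
    have "A j u \<noteq> 0" using jj by auto
    then show "\<exists>w. w < n \<and> w \<noteq> u \<and> A j w \<noteq> 0"
      using low_other[OF jj(1) u(1) low_nbrs_dg_2(1)[OF u j']] by blast
  qed
  then obtain f where f: "\<And>j. j \<in> N \<Longrightarrow> f j < n \<and> f j \<noteq> u \<and> A j (f j) \<noteq> 0" by metis
  have "inj_on f N"
  proof (rule inj_onI, rule ccontr)
    fix i j assume ij: "i \<in> N" "j \<in> N" "f i = f j" "i \<noteq> j"
    then have "A j (f i) = 0" using distinct_others[OF u, of i j "f i"] f[OF ij(1)] by (simp add: N_def)
    then show False using f[OF ij(2)] ij(3) by simp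
  qed
  then have card: "card (f ` N) = 3" using low_nbrs_dg_2(2)[OF u v] by (simp add: card_image N_def)
  have "f ` N \<subseteq> T"
  proof
    fix w assume "w \<in> f ` N"
    then obtain j where j: "j \<in> N" "w = f j" by auto
    have j': "j \<in> low_nbrs u" using j by (simp add: N_def)
    note jj = low_nbrsD[OF u(1) j']
    have w: "w < n" "w \<noteq> u" "A j w \<noteq> 0" using f[OF j(1)] j(2) by auto
    have "A w p = - (A u j * A j w) * A u p" by (rule square_sign[OF u p j' w])
    then have "A w p \<noteq> 0" using p(3) w(3) jj(3) by auto
    then show "w \<in> T" using T(2) w by blast
  qed
  moreover have "finite T" using T(1) card.infinite by fastforce
  ultimately have "f ` N = T" using card_subset_eq card T(1) by metis
  then obtain j where "j \<in> N" "t = f j" using t by auto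
  then show ?thesis using f[of j] by (auto simp: N_def)
qed

text \<open>The vertices \<open>u\<close>, \<open>w1\<close>, \<open>w2\<close>, \<open>w3\<close>
  fill the neighbourhood of \<open>p\<close>. As \<open>w1\<close> also has degree 4, the argument
  made at \<open>u\<close> repeats at \<open>w1\<close> and yields a low vertex \<open>j\<close>
  joining \<open>w1\<close> to \<open>w2\<close>. The negative squares at \<open>p\<close> fix the
  sign of the hexagon \<open>u, i1, w1, j, w2, i2\<close> so that a vector \<open>y\<close> on
  \<open>i1\<close>, \<open>i2\<close>, \<open>j\<close> lies in the kernel of \<open>A\<close>. Its
  square norm 3 just meets the bound \<open>4 * 3 \<le> 3 * 4\<close>.\<close>

lemma no_dg_4_other:
  assumes u: "u < n" "dg u = 4" and N: "low_nbrs u = {i1, i2, i3}" "i1 \<noteq> i2" "i1 \<noteq> i3" "i2 \<noteq> i3"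
    and w1: "w1 < n" "w1 \<noteq> u" "A i1 w1 \<noteq> 0" "dg w1 = 4"
  shows False
proof -
  have iN: "i1 \<in> low_nbrs u" "i2 \<in> low_nbrs u" "i3 \<in> low_nbrs u" using N by auto
  note i1 = low_nbrsD[OF u(1) iN(1)] and i2 = low_nbrsD[OF u(1) iN(2)] and i3 = low_nbrsD[OF u(1) iN(3)]
  note d2 = low_nbrs_dg_2(1)[OF u iN(1)] low_nbrs_dg_2(1)[OF u iN(2)] low_nbrs_dg_2(1)[OF u iN(3)]
  have nz: "A i1 u \<noteq> 0" "A i2 u \<noteq> 0" "A i3 u \<noteq> 0" using i1 i2 i3 by auto
  obtain p where p: "p < n" "wt u p = 1" "dg p = 4"
    "\<And>k. k < n \<Longrightarrow> A u k \<noteq> 0 \<Longrightarrow> k \<in> low_nbrs u \<or> k = p"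
    using fourth_nbr[OF u iN(1)] by blast
  have up: "A u p = 1 \<or> A u p = -1" using wt_1_iff[OF u(1) p(1)] p(2) by simp
  have up0: "A u p \<noteq> 0" using up by auto
  have pN: "p \<notin> low_nbrs u" using p(3) by (auto simp: low_nbrs_def)
  obtain w2 where w2: "w2 < n" "w2 \<noteq> u" "A i2 w2 \<noteq> 0" using low_other[OF i2(1) u(1) d2(2) nz(2)] by blast
  obtain w3 where w3: "w3 < n" "w3 \<noteq> u" "A i3 w3 \<noteq> 0" using low_other[OF i3(1) u(1) d2(3) nz(3)] by blast
  note sgn = square_sign[OF u p(1,3) up0 pN]
  note e1 = sgn[OF iN(1) w1(1-3)] and e2 = sgn[OF iN(2) w2] and e3 = sgn[OF iN(3) w3]
  have b1: "A i1 w1 = 1 \<or> A i1 w1 = -1" using low_entry(1)[OF i1(1) w1(1) _ w1(3)] d2 by simp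
  have b2: "A i2 w2 = 1 \<or> A i2 w2 = -1" using low_entry(1)[OF i2(1) w2(1) _ w2(3)] d2 by simp
  have b3: "A i3 w3 = 1 \<or> A i3 w3 = -1" using low_entry(1)[OF i3(1) w3(1) _ w3(3)] d2 by simp
  have w1p: "A w1 p \<noteq> 0" "wt p w1 = 1" 
    using e1 b1 i1(3) up wt_1_iff[OF w1(1) p(1)] wt_sym[OF w1(1) p(1)] by auto
  have w2p: "wt p w2 = 1" using e2 b2 i2(3) up wt_1_iff[OF w2(1) p(1)] wt_sym[OF w2(1) p(1)] by auto
  have w3p: "wt p w3 = 1" using e3 b3 i3(3) up wt_1_iff[OF w3(1) p(1)] wt_sym[OF w3(1) p(1)] by auto
  have wup: "wt p u = 1" using p(2) wt_sym[OF u(1) p(1)] by simp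
  have z: "A i2 w1 = 0" "A i1 w2 = 0" "A i3 w1 = 0" "A i3 w2 = 0"
    using distinct_others[OF u] iN N w1 w2 by metis+
  have dist: "w1 \<noteq> w2" "w1 \<noteq> w3" "w2 \<noteq> w3" using z w1 w2 w3 by auto
  have p_nbrs: "w \<in> {u, w1, w2, w3}" if w: "w < n" "A w p \<noteq> 0" for w
  proof (rule ccontr)
    assume nw: "w \<notin> {u, w1, w2, w3}"
    have "(\<Sum>l\<in>{w, u, w1, w2, w3}. wt p l) \<le> 4"
      using wt_sum_le_dg[of "{w, u, w1, w2, w3}" p] p(3) u w1 w2 w3 w by simp
    then have "wt p w = 0" using nw dist w1(2) w2(2) w3(2) wup w1p w2p w3p by auto
    then show False using w wt_0_iff[OF p(1) w(1)] A_sym[OF p(1) w(1)] by auto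
  qed
  have i1w: "i1 \<in> low_nbrs w1"
    using low_entry(2)[OF i1(1) w1(1) _ w1(3)] d2(1) i1(1) w1(3) by (simp add: low_nbrs_def)
  have pN1: "p \<notin> low_nbrs w1" using p(3) by (auto simp: low_nbrs_def)
  have "\<exists>j\<in>low_nbrs w1. A j w2 \<noteq> 0"
  proof (rule others_exhaust[OF w1(1,4) p(1,3) w1p(1) pN1 i1w, of "{u, w2, w3}"])
    show "card {u, w2, w3} = 3" using dist w2(2) w3(2) by auto
  qed (use p_nbrs in auto)
  then obtain j where j: "j \<in> low_nbrs w1" "A j w2 \<noteq> 0" by blast
  note jj = low_nbrsD[OF w1(1) j(1)]
  have dj: "dg j = 2" using low_nbrs_dg_2[OF w1(1,4) j(1)] by simp
  have jw1: "A j w1 \<noteq> 0" using jj by auto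
  have ne: "j \<noteq> i1" "j \<noteq> i2" using z j(2) jw1 by auto
  have e4: "A w2 p = - (A w1 j * A j w2) * A w1 p"
    by (rule square_sign[OF w1(1,4) p(1,3) w1p(1) pN1 j(1) w2(1) dist(1)[symmetric] j(2)])
  have c2: "A j w2 = 1 \<or> A j w2 = -1" using low_entry(1)[OF jj(1) w2(1) _ j(2)] dj by simp
  \<comment> \<open>This sign cancels the entry of \<open>Ay\<close> at \<open>w1\<close>; by
    \<open>key\<close> the entry at \<open>w2\<close> then cancels as well.\<close>
  define s where "s = A u i1 * A i1 w1 * A w1 j"
  have s: "s = 1 \<or> s = -1" using i1(3) b1 jj(3) by (auto simp: s_def)
  have key: "A u i2 * A i2 w2 = - (s * A j w2)"
  proof -
    have "- ((A u i2 * A i2 w2) * A u p) = s * A j w2 * A u p"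
      using e4 unfolding e2 e1 s_def by (simp add: algebra_simps)
    then have "(A u i2 * A i2 w2) * A u p = - (s * A j w2) * A u p"
      by (metis minus_minus mult_minus_left)
    then show ?thesis using mult_right_cancel[OF up0] by blast
  qed
  define y where "y = (\<lambda>k. (A u i1 * delta i1 k - A u i2 * delta i2 k) - s * delta j k)"
  have Ay: "ap n A y k = 0" if k: "k < n" for k
  proof -
    have "ap n A y k = A u i1 * A k i1 - A u i2 * A k i2 - s * A k j"
      unfolding y_def ip_ap_simps using i1 i2 jj by (simp add: ap_delta)
    also have "\<dots> = (A u i1 * A i1 u - A u i2 * A i2 u) * delta u k
        + (A u i1 * A i1 w1 - s * A j w1) * delta w1 k - (A u i2 * A i2 w2 + s * A j w2) * delta w2 k"
      using low_column[OF i1(1) d2(1) u(1) nz(1) w1(1-3) k] low_column[OF i2(1) d2(2) u(1) nz(2) w2 k]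
        low_column[OF jj(1) dj w1(1) jw1 w2(1) dist(1)[symmetric] j(2) k]
      by (simp add: algebra_simps)
    also have "A u i1 * A i1 u - A u i2 * A i2 u = 0" using i1 i2 by auto
    also have "A u i1 * A i1 w1 - s * A j w1 = 0" using jj unfolding s_def by auto
    also have "A u i2 * A i2 w2 + s * A j w2 = 0" using key by simp
    finally show ?thesis by simp
  qed
  have AAy: "ap n A (ap n A y) i = 0" for i using Ay by (simp add: ap_def[of n A "ap n A y"])
  have "ip n y y = 3"
  proof -
    have "ip n y y = cnj (A u i1) * A u i1 + cnj (A u i2) * A u i2 + cnj s * s"
      unfolding y_def ip_ap_simps using i1(1) i2(1) jj(1) ne N(2) by (simp add: ip_delta_left delta_simps)
    then show ?thesis using i1(3) i2(3) s by auto
  qed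
  then have extendable
    using i1 i2 s ne N(2) AAy
    by (intro extendable_eigenvector[of y i1 4] ord_diff)
       (auto simp: y_def delta_simps intro!: ord_diff unit_delta_ord)
  then show False using not_extendable by simp
qed

text \<open>Of two second neighbours at least one has degree 4; by the symmetry in \<open>i1\<close>
  and \<open>i2\<close> either can play the role of \<open>w1\<close>.\<close>

lemma low_nbrs_empty:
  assumes u: "u < n" "dg u = 4"
  shows "low_nbrs u = {}"
proof (rule ccontr)
  assume "low_nbrs u \<noteq> {}"
  then obtain v where v: "v \<in> low_nbrs u" by blast
  then obtain i1 i2 i3 where N: "low_nbrs u = {i1, i2, i3}" "i1 \<noteq> i2" "i1 \<noteq> i3" "i2 \<noteq> i3"
    using low_nbrs_dg_2(2)[OF u v] by (auto simp: card_3_iff)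
  have iN: "i1 \<in> low_nbrs u" "i2 \<in> low_nbrs u" using N by auto
  note i1 = low_nbrsD[OF u(1) iN(1)] and i2 = low_nbrsD[OF u(1) iN(2)]
  have nz: "A i1 u \<noteq> 0" "A i2 u \<noteq> 0" using i1 i2 by auto
  obtain w1 where w1: "w1 < n" "w1 \<noteq> u" "A i1 w1 \<noteq> 0"
    using low_other[OF i1(1) u(1) low_nbrs_dg_2(1)[OF u iN(1)] nz(1)] by blast
  obtain w2 where w2: "w2 < n" "w2 \<noteq> u" "A i2 w2 \<noteq> 0"
    using low_other[OF i2(1) u(1) low_nbrs_dg_2(1)[OF u iN(2)] nz(2)] by blast
  obtain p where p: "p < n" "wt u p = 1" "dg p = 4" using fourth_nbr[OF u v] by blast
  have up: "A u p \<noteq> 0" using wt_0_iff[OF u(1) p(1)] p(2) by simp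
  have pN: "p \<notin> low_nbrs u" using p(3) by (auto simp: low_nbrs_def)
  have "dg w1 = 4 \<or> dg w2 = 4"
    using no_two_low_others[OF u p(1,3) up pN iN N(2) w1 _ w2] dg_cases w1 w2 by blast
  then show False
  proof
    assume "dg w1 = 4"
    then show False using no_dg_4_other[OF u N w1] by blast
  next
    assume "dg w2 = 4"
    moreover have "low_nbrs u = {i2, i1, i3}" using N by auto
    ultimately show False using no_dg_4_other[OF u _ _ _ _ w2] N by metis
  qed
qed

section \<open>Graphs with all degrees at most 2\<close>

lemma sum_of_squares:
  assumes low: "\<And>i. i < n \<Longrightarrow> dg i \<le> 2" and e: "e = 1 \<or> e = (-1 :: real)"
  shows "2 * (2 * Re (ip n y y) + e * Re (ip n y (ap n A y))) =
    (\<Sum>(i, j)\<in>{..<n} \<times> {..<n}. real (wt i j) * (cmod (y i + of_real e * A i j * y j))\<^sup>2)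
    + (\<Sum>i<n. 2 * (2 - real (dg i)) * (cmod (y i))\<^sup>2)"
proof -
  \<comment> \<open>All entries are 0 or \<open>\<plusminus>1\<close> here, so each nonzero one
    yields a full square. Ordered pairs count every edge twice, hence the factor 2 in front; a
    charge is the pair \<open>(i, i)\<close>, and \<open>2 - dg i\<close> is what the squares leave
    over of \<open>2 |y i|\<^sup>2\<close>.\<close>
  have summand: "real (wt i j) * (cmod (y i + of_real e * A i j * y j))\<^sup>2 =
      real (wt i j) * (cmod (y i))\<^sup>2 + real (wt j i) * (cmod (y j))\<^sup>2 + 2 * e * Re (cnj (y i) * (A i j * y j))"
    if ij: "i < n" "j < n" for i j
  proof (cases "A i j = 0")
    case True
    then show ?thesis using wt_0_iff[OF ij] wt_sym[OF ij] by simp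
  next
    case False
    note u = low_entry[OF ij low[OF ij(1)] False]
    have "cmod (of_real e * A i j * y j) = cmod (y j)" using u(1) e by (auto simp: norm_mult)
    moreover have "Re (cnj (y i) * (of_real e * A i j * y j)) = e * Re (cnj (y i) * (A i j * y j))"
      by (simp add: algebra_simps)
    ultimately show ?thesis using u(3) wt_sym[OF ij] unfolding cmod_add_sq by simp
  qed
  have "(\<Sum>(i, j)\<in>{..<n} \<times> {..<n}. real (wt i j) * (cmod (y i + of_real e * A i j * y j))\<^sup>2)
     = (\<Sum>i<n. \<Sum>j<n. real (wt i j) * (cmod (y i))\<^sup>2 + real (wt j i) * (cmod (y j))\<^sup>2 + 2 * e * Re (cnj (y i) * (A i j * y j)))"
    unfolding sum.cartesian_product[symmetric] using summand by (intro sum.cong) auto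
  also have "\<dots> = (\<Sum>i<n. \<Sum>j<n. real (wt i j) * (cmod (y i))\<^sup>2) + (\<Sum>i<n. \<Sum>j<n. real (wt j i) * (cmod (y j))\<^sup>2)
      + (\<Sum>i<n. \<Sum>j<n. 2 * e * Re (cnj (y i) * (A i j * y j)))"
    by (simp only: sum.distrib)
  also have "(\<Sum>i<n. \<Sum>j<n. real (wt j i) * (cmod (y j))\<^sup>2) = (\<Sum>j<n. \<Sum>i<n. real (wt j i) * (cmod (y j))\<^sup>2)"
    by (rule sum.swap)
  also have "(\<Sum>i<n. \<Sum>j<n. real (wt i j) * (cmod (y i))\<^sup>2) = (\<Sum>i<n. real (dg i) * (cmod (y i))\<^sup>2)"
    by (simp add: dg_def sum_distrib_right)
  also have "(\<Sum>i<n. \<Sum>j<n. 2 * e * Re (cnj (y i) * (A i j * y j))) = 2 * e * Re (ip n y (ap n A y))"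
    unfolding ip_def ap_def Re_sum sum_distrib_left ..
  finally have S: "(\<Sum>(i, j)\<in>{..<n} \<times> {..<n}. real (wt i j) * (cmod (y i + of_real e * A i j * y j))\<^sup>2)
     = 2 * (\<Sum>i<n. real (dg i) * (cmod (y i))\<^sup>2) + 2 * e * Re (ip n y (ap n A y))" by simp
  have "(\<Sum>i<n. 2 * (2 - real (dg i)) * (cmod (y i))\<^sup>2)
     = (\<Sum>i<n. 4 * (cmod (y i))\<^sup>2 - 2 * (real (dg i) * (cmod (y i))\<^sup>2))"
    by (intro sum.cong) (auto simp: algebra_simps)
  also have "\<dots> = 4 * (\<Sum>i<n. (cmod (y i))\<^sup>2) - 2 * (\<Sum>i<n. real (dg i) * (cmod (y i))\<^sup>2)"
    by (simp only: sum_subtractf sum_distrib_left)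
  finally show ?thesis unfolding S by (simp add: ip_self)
qed

text \<open>A vertex of degree 1 leaves \<open>|y v|\<^sup>2\<close> over in the sum of squares.
  Together with one of the two \<open>|t|\<^sup>2\<close> of an uncharged pendant vertex at
  \<open>v\<close> it dominates the cross term \<open>2 * Re (t * cnj (y v))\<close>.\<close>

lemma no_leaf:
  assumes low: "\<And>i. i < n \<Longrightarrow> dg i \<le> 2" and v: "v < n"
  shows "dg v \<noteq> 1"
proof
  assume d1: "dg v = 1"
  have bound: "(cmod (y v))\<^sup>2 \<le> 2 * Re (ip n y y) + e * Re (ip n y (ap n A y))"
    if e: "e = 1 \<or> e = -1" for e y
  proof -
    have "0 \<le> (\<Sum>(i, j)\<in>{..<n} \<times> {..<n}. real (wt i j) * (cmod (y i + of_real e * A i j * y j))\<^sup>2)"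
      by (intro sum_nonneg) auto
    moreover have "2 * (2 - real (dg v)) * (cmod (y v))\<^sup>2 \<le> (\<Sum>i<n. 2 * (2 - real (dg i)) * (cmod (y i))\<^sup>2)"
      using v low by (intro member_le_sum) (auto intro!: mult_nonneg_nonneg)
    ultimately have "2 * (cmod (y v))\<^sup>2 \<le> 2 * (2 * Re (ip n y y) + e * Re (ip n y (ap n A y)))"
      using sum_of_squares[OF low e, of y] unfolding d1 by simp
    then show ?thesis by simp
  qed
  have "form_bounded (Suc n) (bordered n A (delta v) (of_real 0))"
  proof (rule form_bounded_borderedI)
    fix y t
    have ipv: "ip n y (delta v) = cnj (y v)" using cnj_ip[of n "delta v" y] by (simp add: ip_delta_left v)
    have "2 * \<bar>Re (t * cnj (y v))\<bar> \<le> 2 * (cmod t * cmod (y v))"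
      using abs_Re_le_cmod[of "t * cnj (y v)"] by (simp add: norm_mult)
    also have "\<dots> \<le> (cmod t)\<^sup>2 + (cmod (y v))\<^sup>2"
      using zero_le_power2[of "cmod t - cmod (y v)"] by (simp add: power2_eq_square algebra_simps)
    finally have R: "2 * \<bar>Re (t * cnj (y v))\<bar> \<le> (cmod t)\<^sup>2 + (cmod (y v))\<^sup>2" .
    show "\<bar>Re (ip n y (ap n A y)) + 2 * Re (t * ip n y (delta v)) + 0 * (cmod t)\<^sup>2\<bar>
       \<le> 2 * Re (ip n y y) + 2 * (cmod t)\<^sup>2"
    proof -
      have "(cmod (y v))\<^sup>2 \<le> 2 * Re (ip n y y) + Re (ip n y (ap n A y))"
        "(cmod (y v))\<^sup>2 \<le> 2 * Re (ip n y y) - Re (ip n y (ap n A y))"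
        using bound[of 1 y] bound[of "-1" y] by auto
      then show ?thesis unfolding ipv using R zero_le_power2[of "cmod t"] by linarith
    qed
  qed
  then have extendable
    using v ord_0 ord_1 by (intro extendableI[of "delta v" v 0]) (auto simp: delta_def)
  then show False using not_extendable by simp
qed

text \<open>The new vertex is adjacent to \<open>u\<close> and \<open>w\<close>, closing a 4-cycle of sign \<open>-1\<close> with \<open>v\<close>; the two
  squares contributed by the edges \<open>uv\<close> and \<open>wv\<close> absorb it.\<close>

lemma no_path_vertex:
  assumes low: "\<And>i. i < n \<Longrightarrow> dg i \<le> 2" and v: "v < n"
    and u: "u < n" "u \<noteq> v" "A v u \<noteq> 0" and w: "w < n" "w \<noteq> v" "A v w \<noteq> 0" and uw: "u \<noteq> w"
  shows False
proof -
  note vu = low_entry[OF v u(1) low[OF v] u(3)] and vw = low_entry[OF v w(1) low[OF v] w(3)]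
  have wuv: "wt u v = 1" "wt w v = 1" using vu vw wt_sym v u w by auto
  define b where "b = (\<lambda>i. A v u * delta u i - A v w * delta w i)"
  have key: "0 \<le> 2 * Re (ip n y y) + 2 * (cmod t)\<^sup>2
      + e * (Re (ip n y (ap n A y)) + 2 * Re (t * ip n y b))"
    if e: "e = 1 \<or> e = -1" for e y t
  proof -
    define E where "E = complex_of_real e"
    have E: "E = 1 \<or> E = -1" using e by (auto simp: E_def)
    \<comment> \<open>Up to sign, \<open>a\<close> and \<open>c\<close> are the terms whose squares
      the edges \<open>uv\<close> and \<open>wv\<close> contribute, each twice because pairs are
      ordered.\<close>
    define a where "a = A v u * y u + E * y v"
    define c where "c = A v w * y w + E * y v"
    define f where "f = (\<lambda>(i, j). real (wt i j) * (cmod (y i + E * A i j * y j))\<^sup>2)"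
    have f: "f (u, v) = (cmod a)\<^sup>2" "f (v, u) = (cmod a)\<^sup>2" "f (w, v) = (cmod c)\<^sup>2" "f (v, w) = (cmod c)\<^sup>2"
    proof -
      have 1: "y u + E * A u v * y v = A v u * a" "y v + E * A v u * y u = E * a"
        "y w + E * A w v * y v = A v w * c" "y v + E * A v w * y w = E * c"
        unfolding a_def c_def using E vu(1,2) vw(1,2) by (auto simp: algebra_simps)
      show "f (u, v) = (cmod a)\<^sup>2" "f (v, u) = (cmod a)\<^sup>2" "f (w, v) = (cmod c)\<^sup>2" "f (v, w) = (cmod c)\<^sup>2"
        unfolding f_def prod.case 1 using E vu(1,3) vw(1,3) wuv by (auto simp: norm_mult)
    qed
    have "(\<Sum>x\<in>{(u, v), (v, u), (w, v), (v, w)}. f x) \<le> (\<Sum>x\<in>{..<n} \<times> {..<n}. f x)"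
      using u v w by (intro sum_mono2) (auto simp: f_def)
    moreover have "(\<Sum>x\<in>{(u, v), (v, u), (w, v), (v, w)}. f x) = 2 * (cmod a)\<^sup>2 + 2 * (cmod c)\<^sup>2"
      using u(2) w(2) uw f by simp
    ultimately have "2 * (cmod a)\<^sup>2 + 2 * (cmod c)\<^sup>2 \<le> (\<Sum>x\<in>{..<n} \<times> {..<n}. f x)" by simp
    moreover have "0 \<le> (\<Sum>i<n. 2 * (2 - real (dg i)) * (cmod (y i))\<^sup>2)"
      using low by (intro sum_nonneg mult_nonneg_nonneg) auto
    ultimately have "2 * (cmod a)\<^sup>2 + 2 * (cmod c)\<^sup>2 \<le> 2 * (2 * Re (ip n y y) + e * Re (ip n y (ap n A y)))"
      using sum_of_squares[OF low e, of y] unfolding f_def E_def by simp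
    then have 1: "(cmod a)\<^sup>2 + (cmod c)\<^sup>2 \<le> 2 * Re (ip n y y) + e * Re (ip n y (ap n A y))" by simp
    have "cnj (ip n y b) = ip n b y" by (rule cnj_ip)
    also have "\<dots> = A v u * y u - A v w * y w"
      unfolding b_def ip_ap_simps using u w vu(1) vw(1) by (auto simp: ip_delta_left)
    \<comment> \<open>The opposite signs in \<open>b\<close> cancel \<open>E * y v\<close>. The
      cross term thus splits over the two edges, and each takes one \<open>|t|\<^sup>2\<close> to
      form the squares \<open>|Et + a|\<^sup>2\<close> and \<open>|c - Et|\<^sup>2\<close>.\<close>
    finally have "cnj (ip n y b) = a - c" by (simp add: a_def c_def)
    then have "cnj (t * ip n y b) = cnj t * (a - c)" by simp
    then have "Re (t * ip n y b) = Re (cnj t * (a - c))" by (metis cnj.simps(1))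
    then have "e * Re (t * ip n y b) = e * Re (cnj t * a) - e * Re (cnj t * c)"
      by (simp only: right_diff_distrib minus_complex.simps)
    moreover have "0 \<le> (cmod (E * t + a))\<^sup>2" "0 \<le> (cmod (- (E * t) + c))\<^sup>2" by auto
    moreover have "(cmod (E * t + a))\<^sup>2 = (cmod t)\<^sup>2 + (cmod a)\<^sup>2 + 2 * (e * Re (cnj t * a))"
      unfolding cmod_add_sq using e by (auto simp: E_def)
    moreover have "(cmod (- (E * t) + c))\<^sup>2 = (cmod t)\<^sup>2 + (cmod c)\<^sup>2 - 2 * (e * Re (cnj t * c))"
      unfolding cmod_add_sq using e by (auto simp: E_def)
    ultimately have "0 \<le> (cmod a)\<^sup>2 + (cmod c)\<^sup>2 + 2 * (cmod t)\<^sup>2 + 2 * (e * Re (t * ip n y b))" by argo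
    then show ?thesis using 1 by (simp add: algebra_simps)
  qed
  have "form_bounded (Suc n) (bordered n A b (of_real 0))"
  proof (rule form_bounded_borderedI)
    fix y t
    show "\<bar>Re (ip n y (ap n A y)) + 2 * Re (t * ip n y b) + 0 * (cmod t)\<^sup>2\<bar>
       \<le> 2 * Re (ip n y y) + 2 * (cmod t)\<^sup>2"
      using key[of 1 y t] key[of "-1" y t] by (simp add: abs_le_iff)
  qed
  moreover have "b i \<in> ord" for i unfolding b_def using vu vw by (intro ord_diff unit_delta_ord) auto
  moreover have "b u \<noteq> 0" using uw vu by (auto simp: b_def delta_simps)
  ultimately have extendable using u by (intro extendableI[of b u 0]) auto
  then show False using not_extendable by simp
qed

text \<open>The two vertices form a component of their own. For equal charges their columns agree up
  to sign; for opposite charges \<open>A\<^sup>2e\<^sub>v = 2e\<^sub>v\<close>, so \<open>D\<close>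
  acts on \<open>e\<^sub>v\<close> as 2, and \<open>4 * 1 \<le> 3 * 2\<close>.\<close>

lemma no_charged_edge:
  assumes v: "v < n" "A v v \<noteq> 0" "dg v = 2" and u: "u < n" "A u u \<noteq> 0" "dg u = 2"
    and uv: "u \<noteq> v" "A v u \<noteq> 0"
  shows False
proof -
  have uv': "A u v \<noteq> 0" "A u v = A v u" "A v u = 1 \<or> A v u = -1"
    using low_entry[OF v(1) u(1) _ uv(2)] v(3) uv(2) by auto
  have c: "A v v = 1 \<or> A v v = -1" "A u u = 1 \<or> A u u = -1" using diag v u by auto
  have colv: "A k v = A v v * delta v k + A v u * delta u k" if "k < n" for k
    by (rule low_column[OF v(1,3,1,2) u(1) uv that])
  have colu: "A k u = A u u * delta u k + A v u * delta v k" if "k < n" for k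
    using low_column[OF u(1,3,1,2) v(1) uv(1)[symmetric] uv'(1) that] uv'(2) by simp
  have "sq k v = (A v v * A v v + A v u * A v u) * delta v k + (A v v + A u u) * A v u * delta u k" if k: "k < n" for k
  proof -
    have "sq k v = A k v * A v v + A k u * A u v" unfolding sq_def
      using colv uv(1) by (intro sum_two v u) (auto simp: delta_simps)
    then show ?thesis unfolding colv[OF k] colu[OF k] uv'(2) by (simp add: algebra_simps)
  qed
  moreover have "A v v * A v v + A v u * A v u = 2" using c uv' by auto
  ultimately have sqv: "sq k v = 2 * delta v k + (A v v + A u u) * A v u * delta u k" if "k < n" for k
    using that by simp
  show False
  proof (cases "A v v = A u u")
    case True
    show False
    proof (rule no_equal_columns[OF v(1) u(1) uv(1)[symmetric] _ uv'(3), of "A v v"])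
      show "A v v * A k v = A v u * A k u" if "k < n" for k
        unfolding colv[OF that] colu[OF that] True using c(2) uv'(3) by auto
    qed (use c in auto)
  next
    case False
    then have "A v v + A u u = 0" using c by auto
    then have "ap n A (ap n A (delta v)) k = of_real (4 - 2) * delta v k" if "k < n" for k
      using sqv[OF that] v by (simp add: ap_ap_delta)
    then have extendable
      using v unit_delta_ord[of 1] by (intro extendable_eigenvector[of "delta v" v 2])
        (simp_all add: ip_delta_left delta_simps)
    then show False using not_extendable by simp
  qed
qed

text \<open>A vertex with two distinct neighbours other than itself can be doubled, so one of its
  two units of degree must be its charge. The same then holds for its only neighbour, and two
  charged vertices joined by an edge are excluded.\<close>

lemma no_low_graph:
  assumes low: "\<And>i. i < n \<Longrightarrow> dg i \<le> 2" and v: "v < n"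
  shows "dg v = 0"
proof (rule ccontr)
  assume "dg v \<noteq> 0"
  then have d2: "dg v = 2" using low[OF v] no_leaf[OF low v] by linarith
  have two: "\<exists>w<n. w \<noteq> u \<and> A v w \<noteq> 0" if "v < n" "dg v = 2" "u < n" "A v u \<noteq> 0" for u v
    using low_other[OF that(1,3,2,4)] by blast
  have "\<exists>u<n. A v u \<noteq> 0"
  proof (rule ccontr)
    assume "\<not> ?thesis"
    then have "wt v k = 0" if "k < n" for k using that wt_0_iff[OF v] by blast
    then show False using d2 by (simp add: dg_def)
  qed
  then obtain u where u: "u < n" "A v u \<noteq> 0" by blast
  obtain w where w: "w < n" "w \<noteq> u" "A v w \<noteq> 0" using two[OF v d2 u] by blast
  \<comment> \<open>One of \<open>u\<close> and \<open>w\<close> must be \<open>v\<close> itself,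
    which means that \<open>v\<close> is charged; the other one is \<open>x\<close>.\<close>
  obtain x where x: "x < n" "x \<noteq> v" "A v x \<noteq> 0" "A v v \<noteq> 0"
    using no_path_vertex[OF low v u(1) _ u(2) w(1) _ w(3) w(2)[symmetric]] u w by blast
  have xv: "A x v \<noteq> 0" using low_entry[OF v x(1) low[OF v] x(3)] by auto
  have "dg x \<noteq> 0" using wt_le_dg[OF v, of x] wt_0_iff[OF x(1) v] xv by auto
  then have dx: "dg x = 2" using low[OF x(1)] no_leaf[OF low x(1)] by linarith
  obtain y where y: "y < n" "y \<noteq> v" "A x y \<noteq> 0" using two[OF x(1) dx v xv] by blast
  show False
  proof (cases "y = x")
    case True
    then show False using no_charged_edge[OF v x(4) d2 x(1) _ dx x(2,3)] y by blast
  next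
    case False
    then show False using no_path_vertex[OF low x(1) v x(2)[symmetric] xv y(1) _ y(3)] y(2) by blast
  qed
qed

text \<open>If vertices of degree 4 and of lower degree both occurred, connectedness would give an
  edge between the two kinds, that is, a low neighbour of a vertex of degree 4.\<close>

lemma dg_0_or_4:
  assumes con: "\<And>S. S \<subseteq> {..<n} \<Longrightarrow> S \<noteq> {} \<Longrightarrow> S \<noteq> {..<n} \<Longrightarrow> \<exists>i\<in>S. \<exists>j\<in>{..<n} - S. A i j \<noteq> 0 \<or> A j i \<noteq> 0"
    and v: "v < n"
  shows "dg v = 0 \<or> dg v = 4"
proof (rule ccontr)
  assume nv: "\<not> ?thesis"
  define S where "S = {i. i < n \<and> dg i = 4}"
  have "S \<noteq> {}"
  proof
    assume "S = {}"
    then have "dg i \<le> 2" if "i < n" for i using dg_cases[OF that] that by (auto simp: S_def)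
    then show False using no_low_graph v nv by blast
  qed
  moreover have "S \<subseteq> {..<n}" "S \<noteq> {..<n}" using v nv by (auto simp: S_def)
  ultimately obtain i j where ij: "i \<in> S" "j \<in> {..<n} - S" "A i j \<noteq> 0 \<or> A j i \<noteq> 0" using con by blast
  then have i: "i < n" "dg i = 4" and j: "j < n" "dg j \<le> 2" using dg_cases[of j] by (auto simp: S_def)
  have "A i j \<noteq> 0" using ij(3) A_sym[OF j(1) i(1)] by auto
  then have "j \<in> low_nbrs i" using j by (simp add: low_nbrs_def)
  then show False using low_nbrs_empty[OF i] by simp
qed

end

section \<open>Return to weighted degrees and maximality\<close>

lemma weighted_degree_eq:
  assumes "v < dim_row G" "G $$ (v, v) \<in> {0, 1, -1}"
  shows "weighted_degree G v = (\<Sum>j<dim_row G. of_real ((cmod (G $$ (v, j)))\<^sup>2))"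
proof -
  define f where "f j = G $$ (v, j) * cnj (G $$ (v, j))" for j
  have "(\<Sum>j<dim_row G. of_real ((cmod (G $$ (v, j)))\<^sup>2)) = (\<Sum>j<dim_row G. f j)"
    unfolding f_def complex_norm_square ..
  also have "\<dots> = f v + (\<Sum>j\<in>{..<dim_row G} - {v}. f j)" using assms(1) by (simp add: sum.remove)
  also have "(\<Sum>j\<in>{..<dim_row G} - {v}. f j) = (\<Sum>j\<in>{j. j < dim_row G \<and> j \<noteq> v \<and> G $$ (v, j) \<noteq> 0}. f j)"
    by (rule sum.mono_neutral_right) (auto simp: f_def)
  also have "f v = (if G $$ (v, v) \<noteq> 0 then 1 else 0)" using assms(2) by (auto simp: f_def)
  finally show ?thesis by (simp add: weighted_degree_def f_def)
qed

theorem theorem9: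
  fixes d :: int and G :: "complex mat"
  assumes "d \<in> {-2, -7}"
    and "L_graph d G" and "cyclotomic G"
    and "\<exists>v < dim_row G. weighted_degree G v \<in> {1, 2, 3}"
  shows "\<not> maximal_graph d G"
proof
  assume max: "maximal_graph d G"
  define n where "n = dim_row G"
  have G: "G \<in> carrier_mat n n" and diag: "\<And>i. i < n \<Longrightarrow> G $$ (i, i) \<in> {0, 1, -1}"
    and lab: "\<And>i j. i < n \<Longrightarrow> j < n \<Longrightarrow> i \<noteq> j \<Longrightarrow> G $$ (i, j) \<in> edge_labels d"
    using assms(2) by (auto simp: L_graph_def n_def)
  have H: "hermitian_on n (entry G)" using assms(2) adjoint_entry[OF G] by (simp add: L_graph_def)
  obtain \<omega> \<tau> where q: "quadratic_order \<omega> \<tau>" and sub: "quadratic_order.ord \<omega> \<subseteq> quadratic_integers d"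
    and lab_ord: "edge_labels d \<subseteq> quadratic_order.ord \<omega>"
    using quadratic_order_exists[OF assms(1)] by blast
  interpret quadratic_order \<omega> \<tau> by (rule q)
  interpret label_matrix \<omega> \<tau> n "entry G"
  proof
    show "form_bounded n (entry G)" using cyclotomic_iff_form_bounded[OF G H] assms(3) by simp
    show "entry G i j \<in> ord" if "i < n" "j < n" for i j
    proof (cases "i = j")
      case True
      then show ?thesis using diag[OF that(1)] ord_0 ord_1 ord_minus[OF ord_1] by (auto simp: entry_def)
    next
      case False
      then show ?thesis using lab[OF that] lab_ord by (auto simp: entry_def)
    qed
    show "entry G i i \<in> {0, 1, -1}" if "i < n" for i using diag[OF that] by (simp add: entry_def)
  qed (rule H)
  \<comment> \<open>Maximality enters here: an integral border keeping the form bounded would give a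
    larger connected cyclotomic graph.\<close>
  interpret nonextendable_matrix \<omega> \<tau> n "entry G"
  proof
    show "\<not> extendable"
      unfolding extendable_def using extension_not_maximal[OF sub assms(2) n_def[symmetric]] max by blast
  qed
  obtain v where v: "v < n" "weighted_degree G v \<in> {1, 2, 3}" using assms(4) by (auto simp: n_def)
  have "weighted_degree G v = of_real (\<Sum>j<n. (cmod (entry G v j))\<^sup>2)"
    using weighted_degree_eq[of v G] v(1) diag by (simp add: n_def entry_def)
  also have "\<dots> = of_nat (dg v)" unfolding dg[OF v(1)] by simp
  finally have "of_nat (dg v) \<in> {1, 2, 3 :: complex}" using v(2) by simp
  then have "dg v \<in> {1, 2, 3}" by (auto simp: of_nat_eq_1_iff) (metis of_nat_eq_iff of_nat_numeral)+
  moreover have "dg v = 0 \<or> dg v = 4"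
  proof (rule dg_0_or_4[OF _ v(1)])
    fix S assume "S \<subseteq> {..<n}" "S \<noteq> {}" "S \<noteq> {..<n}"
    then show "\<exists>i\<in>S. \<exists>j\<in>{..<n} - S. entry G i j \<noteq> 0 \<or> entry G j i \<noteq> 0"
      unfolding entry_def using connected_graph_no_cut[OF G] max by (auto simp: maximal_graph_def)
  qed
  ultimately show False by auto
qed

end
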